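(* Let $d\in\mathbb N$, let $\Omega\subset\mathbb R^d$ be a bounded domain, let $\omega\in\mathbb R$, $p\in\mathbb N$ and $T:=2\pi p/\omega$, where $T>0$. Let $\lambda>0$ and let $I\colon[0,T]\times\Omega\to\mathbb R$ be of class $C^1$. Let $\varepsilon>0$ and let $u\colon[0,T]\times\Omega\to\mathbb R^d$ of class $C^1$ be fixed. Consider the functional $$E_{u,\varepsilon}(v)=\int_\Omega\int_0^T\Big(q_\varepsilon\big(G_v(t,x),G_u(t,x)\big)+\lambda\,\|\nabla v(t,x)\|^2\Big)\,\mathrm dt\,\mathrm dx$$ on the set of flow velocities of the form $v(t,x)=\operatorname{Re}\big(a(x)\,\mathrm e^{\mathrm i\omega t}\big)$ with $a\colon\Omega\to\mathbb C^d$ of class $C^2$. If $v$ is a minimizer of $E_{u,\varepsilon}$ over this set (with finite value), then its amplitude $a$ satisfies, for all $x\in\Omega$, $$\mathcal F[w_{\mathcal D}\nabla I\,\nabla I^{\mathrm T}](0,x)\,a(x)+\mathcal F[w_{\mathcal D}\nabla I\,\nabla I^{\mathrm T}](2\omega,x)\,\overline{a(x)}+2\,\mathcal F[w_{\mathcal D}\,\partial_tI\,\nabla I](\omega,x)=2\lambda T\,\Delta a(x),$$ where $$w_{\mathcal D}(t,x)=\frac1{\max\{\varepsilon,|G_u(t,x)|\}}.$$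
   Context: For a velocity field $w\colon[0,T]\times\Omega\to\mathbb R^d$, $G_w(t,x):=\nabla I(t,x)^{\mathrm T}w(t,x)+\partial_tI(t,x)$. For $\varepsilon>0$ and $x,z\in\mathbb R$, $q_\varepsilon(x,z):=\frac{|x|^2}{2\max\{\varepsilon,|z|\}}+\frac12\max\{\varepsilon,|z|\}$. $\nabla$ denotes the gradient (for vector-valued functions, the Jacobian) with respect to the spatial variable $x\in\mathbb R^d$ only, and $\nabla I$ is a column vector. $\|\cdot\|$ is the Frobenius norm, $\|\nabla v\|^2=\sum_{j,k=1}^d|\partial_{x_j}v_k|^2$. $\Delta$ is the spatial Laplace operator applied componentwise, and $\overline{a}$ is the componentwise complex conjugate. $\mathcal F$ is the Fourier transform in the time variable with $x$ fixed, applied entrywise to vector- or matrix-valued functions: for $f$ defined on $[0,T]\times\Omega$, $\mathcal F[f](\nu,x)=\int_0^Tf(t,x)\,\mathrm e^{-\mathrm i t\nu}\,\mathrm dt$ for $\nu\in\mathbb R$. *)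

theory Defs
  imports "HOL-Analysis.Analysis"
begin

text \<open>
  Continuous differentiability relative to a set \<open>S\<close>. It is used for open sets and for
  products \<open>{0..T} \<times> \<Omega>\<close> with \<open>\<Omega>\<close> open, where derivatives within \<open>S\<close> are unique
  and amount to one-sided time derivatives at the end points of \<open>{0..T}\<close>.
\<close>

definition C1_on :: "('a::real_normed_vector) set \<Rightarrow> ('a \<Rightarrow> 'b::real_normed_vector) \<Rightarrow> bool" where
  "C1_on S f \<longleftrightarrow> (\<exists>D :: 'a \<Rightarrow> 'a \<Rightarrow>\<^sub>L 'b.
     (\<forall>z\<in>S. (f has_derivative blinfun_apply (D z)) (at z within S)) \<and> continuous_on S D)"

definition C2_on :: "('a::real_normed_vector) set \<Rightarrow> ('a \<Rightarrow> 'b::real_normed_vector) \<Rightarrow> bool" where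
  "C2_on S f \<longleftrightarrow> (\<exists>D :: 'a \<Rightarrow> 'a \<Rightarrow>\<^sub>L 'b.
     (\<forall>z\<in>S. (f has_derivative blinfun_apply (D z)) (at z within S)) \<and> C1_on S D)"

definition partial_deriv :: "'d \<Rightarrow> (real^'d \<Rightarrow> 'b::real_normed_vector) \<Rightarrow> real^'d \<Rightarrow> 'b" where
  "partial_deriv j f x = frechet_derivative f (at x) (axis j 1)"

definition grad :: "(real^'d \<Rightarrow> real) \<Rightarrow> real^'d \<Rightarrow> real^'d" where
  "grad f x = (\<chi> j. partial_deriv j f x)"

definition laplacian :: "(real^'d \<Rightarrow> complex^'n) \<Rightarrow> real^'d \<Rightarrow> complex^'n" where
  "laplacian f x = (\<chi> k. \<Sum>j\<in>UNIV. partial_deriv j (partial_deriv j (\<lambda>y. f y $ k)) x)"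

definition time_deriv :: "real \<Rightarrow> (real \<Rightarrow> 'x \<Rightarrow> real) \<Rightarrow> real \<Rightarrow> 'x \<Rightarrow> real" where
  "time_deriv T f t x = vector_derivative (\<lambda>s. f s x) (at t within {0..T})"

definition G :: "real \<Rightarrow> (real \<Rightarrow> real^'d \<Rightarrow> real) \<Rightarrow> (real \<Rightarrow> real^'d \<Rightarrow> real^'d)
    \<Rightarrow> real \<Rightarrow> real^'d \<Rightarrow> real" where
  "G T I w t x = grad (I t) x \<bullet> w t x + time_deriv T I t x"

definition q :: "real \<Rightarrow> real \<Rightarrow> real \<Rightarrow> real" where
  "q \<epsilon> x z = \<bar>x\<bar>\<^sup>2 / (2 * max \<epsilon> \<bar>z\<bar>) + 1/2 * max \<epsilon> \<bar>z\<bar>"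

text \<open>
  The integrand is nonnegative, so the functional takes values in \<open>[0, \<infinity>]\<close>.
  The norm of a matrix of type \<open>real^'d^'d\<close> is the Frobenius norm.
\<close>

definition energy :: "real \<Rightarrow> real \<Rightarrow> real \<Rightarrow> (real^'d) set \<Rightarrow> (real \<Rightarrow> real^'d \<Rightarrow> real)
    \<Rightarrow> (real \<Rightarrow> real^'d \<Rightarrow> real^'d) \<Rightarrow> (real \<Rightarrow> real^'d \<Rightarrow> real^'d) \<Rightarrow> ennreal" where
  "energy \<epsilon> lam T \<Omega> I u v =
     (\<integral>\<^sup>+x\<in>\<Omega>. (\<integral>\<^sup>+t\<in>{0..T}.
        ennreal (q \<epsilon> (G T I v t x) (G T I u t x) + lam * (norm (jacobian (v t) (at x)))\<^sup>2)
      \<partial>lborel) \<partial>lborel)"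

definition harmonic_flow :: "real \<Rightarrow> (real^'d \<Rightarrow> complex^'d) \<Rightarrow> real \<Rightarrow> real^'d \<Rightarrow> real^'d" where
  "harmonic_flow \<omega> a t x = (\<chi> k. Re (a x $ k * exp (\<i> * of_real (\<omega> * t))))"

definition harmonic_flows :: "real \<Rightarrow> (real^'d) set \<Rightarrow> (real \<Rightarrow> real^'d \<Rightarrow> real^'d) set" where
  "harmonic_flows \<omega> \<Omega> = {harmonic_flow \<omega> a | a. C2_on \<Omega> a}"

definition w_D :: "real \<Rightarrow> real \<Rightarrow> (real \<Rightarrow> real^'d \<Rightarrow> real) \<Rightarrow> (real \<Rightarrow> real^'d \<Rightarrow> real^'d)
    \<Rightarrow> real \<Rightarrow> real^'d \<Rightarrow> real" where
  "w_D \<epsilon> T I u t x = 1 / max \<epsilon> \<bar>G T I u t x\<bar>"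

definition outer_prod :: "real^'m \<Rightarrow> real^'n \<Rightarrow> real^'n^'m" where
  "outer_prod g h = (\<chi> j k. g $ j * h $ k)"

definition fourier :: "real \<Rightarrow> (real \<Rightarrow> 'x \<Rightarrow> real) \<Rightarrow> real \<Rightarrow> 'x \<Rightarrow> complex" where
  "fourier T f \<nu> x = (LINT t:{0..T}|lborel. of_real (f t x) * exp (- (\<i> * of_real (t * \<nu>))))"

definition fourier_vec :: "real \<Rightarrow> (real \<Rightarrow> 'x \<Rightarrow> real^'n) \<Rightarrow> real \<Rightarrow> 'x \<Rightarrow> complex^'n" where
  "fourier_vec T f \<nu> x = (\<chi> j. fourier T (\<lambda>t y. f t y $ j) \<nu> x)"

definition fourier_mat :: "real \<Rightarrow> (real \<Rightarrow> 'x \<Rightarrow> real^'n^'m) \<Rightarrow> real \<Rightarrow> 'x \<Rightarrow> complex^'n^'m" where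
  "fourier_mat T f \<nu> x = (\<chi> j k. fourier T (\<lambda>t y. f t y $ j $ k) \<nu> x)"

definition cnj_vec :: "complex^'n \<Rightarrow> complex^'n" where
  "cnj_vec z = (\<chi> k. cnj (z $ k))"

end

theory Submission
  imports Defs
begin

text \<open>
  Since \<open>q\<close> is quadratic in its first argument, \<open>energy (v + s h)\<close> is a quadratic polynomial in \<open>s\<close>
  as soon as \<open>h\<close> has compact support in \<open>\<Omega>\<close>, and minimality forces its linear coefficient to vanish.
  Take \<open>h\<close> with amplitude \<open>bump z r x *\<^sub>R axis k \<gamma>\<close>, where \<open>\<gamma>\<close> is \<open>1\<close> or \<open>\<i>\<close>. As \<open>T\<close> is a multiple
  of the period, the time integral of the smoothness term is \<open>T/2\<close> times the real Hermitian product of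
  the amplitude gradients; the data term gives a Fourier coefficient of \<open>w_D G_v \<nabla>I\<close> at \<open>\<omega>\<close>.
  Integrating by parts in \<open>x\<close> and letting the bump vary gives the Euler-Lagrange equation
  \<open>\<F>[w_D G_v \<nabla>I](\<omega>) = \<lambda> T \<Delta>a\<close>. Expanding \<open>G_v\<close> with
  \<open>2 Re (a e\<^bsup>i\<omega>t\<^esup>) e\<^bsup>-i\<omega>t\<^esup> = a + cnj a e\<^bsup>-2i\<omega>t\<^esup>\<close> yields the claim.
\<close>

subsection \<open>Continuously differentiable functions\<close>

text \<open>On an open set the derivative is unique, so the witness \<open>D\<close> must be
  \<open>frechet_derivative\<close>. The domain is finite-dimensional, so continuity in operator
  norm can be tested on fixed vectors. The resulting criterion is pointwise and local, which is what
  gluing needs.\<close>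

lemma C1_on_open_iff:
  fixes f :: "'a::euclidean_space \<Rightarrow> 'b::real_normed_vector"
  assumes "open S"
  shows "C1_on S f \<longleftrightarrow> (\<forall>x\<in>S. f differentiable (at x)) \<and>
    (\<forall>h. continuous_on S (\<lambda>x. frechet_derivative f (at x) h))"
proof
  assume "C1_on S f"
  then obtain D where D: "\<forall>z\<in>S. (f has_derivative blinfun_apply (D z)) (at z within S)"
      "continuous_on S D"
    unfolding C1_on_def by blast
  then have *: "(f has_derivative blinfun_apply (D z)) (at z)" if "z \<in> S" for z
    using assms that by (metis at_within_open)
  have "continuous_on S (\<lambda>x. frechet_derivative f (at x) h)" for h
  proof -
    have "continuous_on S (\<lambda>x. blinfun_apply (D x) h)"
      using D(2) by (intro continuous_intros)
    then show ?thesis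
      by (rule continuous_on_eq) (metis * frechet_derivative_at)
  qed
  then show "(\<forall>x\<in>S. f differentiable (at x)) \<and>
    (\<forall>h. continuous_on S (\<lambda>x. frechet_derivative f (at x) h))"
    using * differentiable_def by blast
next
  assume *: "(\<forall>x\<in>S. f differentiable (at x)) \<and>
    (\<forall>h. continuous_on S (\<lambda>x. frechet_derivative f (at x) h))"
  define D where "D x = Blinfun (frechet_derivative f (at x))" for x
  have D: "blinfun_apply (D x) = frechet_derivative f (at x)" if "x \<in> S" for x
    unfolding D_def using * that
    by (intro bounded_linear_Blinfun_apply) (metis frechet_derivative_works has_derivative_bounded_linear)
  have "continuous_on S D"
  \<comment> \<open>Here finite dimension enters: it suffices to check the images of the basis
    vectors.\<close>
  proof (rule continuous_on_blinfun_componentwise)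
    fix i :: 'a
    have "continuous_on S (\<lambda>x. frechet_derivative f (at x) i)" using * by blast
    then show "continuous_on S (\<lambda>x. blinfun_apply (D x) i)"
      by (rule continuous_on_eq) (simp add: D)
  qed
  moreover have "\<forall>z\<in>S. (f has_derivative blinfun_apply (D z)) (at z within S)"
    using * D by (metis frechet_derivative_works has_derivative_at_withinI)
  ultimately show "C1_on S f" unfolding C1_on_def by blast
qed

lemma C1_on_imp_continuous_on: "C1_on S f \<Longrightarrow> continuous_on S f"
  unfolding C1_on_def by (meson continuous_on_eq_continuous_within has_derivative_continuous)

text \<open>A derivative within \<open>S\<close> sees only the values on \<open>S\<close>. This
  permits replacing functions such as \<open>partial_deriv\<close>, whose values off
  \<open>S\<close> are uncontrolled.\<close>

lemma C1_on_cong: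
  assumes "\<And>x. x \<in> S \<Longrightarrow> f x = g x"
  shows "C1_on S f \<longleftrightarrow> C1_on S g"
proof -
  have "(f has_derivative D) (at x within S) \<longleftrightarrow> (g has_derivative D) (at x within S)" if "x \<in> S" for x D
    using that assms has_derivative_transform[of x S f g D] has_derivative_transform[of x S g f D] by auto
  then have "(\<forall>z\<in>S. (f has_derivative blinfun_apply (D z)) (at z within S)) \<longleftrightarrow>
      (\<forall>z\<in>S. (g has_derivative blinfun_apply (D z)) (at z within S))" for D
    by auto
  then show ?thesis unfolding C1_on_def by presburger
qed

lemma C1_on_const: "C1_on S (\<lambda>x. c)"
  unfolding C1_on_def by (rule exI[of _ "\<lambda>_. 0"]) (simp add: zero_blinfun.rep_eq)

text \<open>Both sets being open, differentiability at a point of either does not depend on the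
  other. This glues a compactly supported product to its extension by zero.\<close>

lemma C1_on_Un:
  fixes f :: "'a::euclidean_space \<Rightarrow> 'b::real_normed_vector"
  assumes "open S" "open R" "C1_on S f" "C1_on R f"
  shows "C1_on (S \<union> R) f"
  using assms by (simp add: C1_on_open_iff open_Un continuous_on_open_Un ball_Un)

lemma C1_on_bounded_linear:
  assumes "bounded_linear L" "C1_on S f"
  shows "C1_on S (\<lambda>x. L (f x))"
proof -
  obtain D where D: "\<forall>z\<in>S. (f has_derivative blinfun_apply (D z)) (at z within S)" "continuous_on S D"
    using assms(2) unfolding C1_on_def by blast
  have "((\<lambda>x. L (f x)) has_derivative blinfun_apply (Blinfun L o\<^sub>L D z)) (at z within S)" if "z \<in> S" for z
  proof -
    have "blinfun_apply (Blinfun L o\<^sub>L D z) = (\<lambda>h. L (D z h))"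
      using assms(1) by (auto simp: bounded_linear_Blinfun_apply)
    then show ?thesis
      using bounded_linear.has_derivative[OF assms(1), of f "blinfun_apply (D z)"] D(1) that by simp
  qed
  moreover have "continuous_on S (\<lambda>z. Blinfun L o\<^sub>L D z)"
    using D(2) by (intro continuous_intros)
  ultimately show ?thesis unfolding C1_on_def by (intro exI[of _ "\<lambda>z. Blinfun L o\<^sub>L D z"]) auto
qed

lemma C1_on_add:
  assumes "C1_on S f" "C1_on S g"
  shows "C1_on S (\<lambda>x. f x + g x)"
proof -
  obtain D where D: "\<forall>z\<in>S. (f has_derivative blinfun_apply (D z)) (at z within S)" "continuous_on S D"
    using assms(1) unfolding C1_on_def by blast
  obtain D' where D': "\<forall>z\<in>S. (g has_derivative blinfun_apply (D' z)) (at z within S)" "continuous_on S D'"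
    using assms(2) unfolding C1_on_def by blast
  have "((\<lambda>x. f x + g x) has_derivative blinfun_apply (D z + D' z)) (at z within S)" if "z \<in> S" for z
    using D(1) D'(1) that has_derivative_add[of f "D z" "at z within S" g "D' z"]
    by (simp add: plus_blinfun.rep_eq)
  moreover have "continuous_on S (\<lambda>z. D z + D' z)"
    using D(2) D'(2) by (intro continuous_intros)
  ultimately show ?thesis unfolding C1_on_def by (intro exI[of _ "\<lambda>z. D z + D' z"]) auto
qed

lemma C1_on_scaleR:
  assumes "C1_on S f" "C1_on S g"
  shows "C1_on S (\<lambda>x. f x *\<^sub>R g x)"
proof -
  obtain D where D: "\<forall>z\<in>S. (f has_derivative blinfun_apply (D z)) (at z within S)" "continuous_on S D"
    using assms(1) unfolding C1_on_def by blast
  obtain D' where D': "\<forall>z\<in>S. (g has_derivative blinfun_apply (D' z)) (at z within S)" "continuous_on S D'"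
    using assms(2) unfolding C1_on_def by blast
  let ?D = "\<lambda>z. f z *\<^sub>R D' z + (blinfun_scaleR_left (g z) o\<^sub>L D z)"
  have "((\<lambda>x. f x *\<^sub>R g x) has_derivative blinfun_apply (?D z)) (at z within S)" if "z \<in> S" for z
    using D(1) D'(1) that has_derivative_scaleR[of f "D z" z S g "D' z"]
    by (simp add: plus_blinfun.rep_eq scaleR_blinfun.rep_eq)
  moreover have "continuous_on S ?D"
    using D(2) D'(2) C1_on_imp_continuous_on[OF assms(1)] C1_on_imp_continuous_on[OF assms(2)]
    by (intro continuous_intros)
  ultimately show ?thesis unfolding C1_on_def by (intro exI[of _ ?D]) auto
qed

lemma C2_on_add:
  assumes "C2_on S f" "C2_on S g"
  shows "C2_on S (\<lambda>x. f x + g x)"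
proof -
  obtain D where D: "\<forall>z\<in>S. (f has_derivative blinfun_apply (D z)) (at z within S)" "C1_on S D"
    using assms(1) unfolding C2_on_def by blast
  obtain D' where D': "\<forall>z\<in>S. (g has_derivative blinfun_apply (D' z)) (at z within S)" "C1_on S D'"
    using assms(2) unfolding C2_on_def by blast
  have "((\<lambda>x. f x + g x) has_derivative blinfun_apply (D z + D' z)) (at z within S)" if "z \<in> S" for z
    using D(1) D'(1) that has_derivative_add[of f "D z" "at z within S" g "D' z"]
    by (simp add: plus_blinfun.rep_eq)
  then show ?thesis unfolding C2_on_def
    using C1_on_add[OF D(2) D'(2)] by (intro exI[of _ "\<lambda>z. D z + D' z"]) auto
qed

lemma C2_on_bounded_linear:
  assumes "bounded_linear L" "C2_on S f"
  shows "C2_on S (\<lambda>x. L (f x))"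
proof -
  obtain D where D: "\<forall>z\<in>S. (f has_derivative blinfun_apply (D z)) (at z within S)" "C1_on S D"
    using assms(2) unfolding C2_on_def by blast
  have "((\<lambda>x. L (f x)) has_derivative blinfun_apply (Blinfun L o\<^sub>L D z)) (at z within S)" if "z \<in> S" for z
  proof -
    have "blinfun_apply (Blinfun L o\<^sub>L D z) = (\<lambda>h. L (D z h))"
      using assms(1) by (auto simp: bounded_linear_Blinfun_apply)
    then show ?thesis
      using bounded_linear.has_derivative[OF assms(1), of f "blinfun_apply (D z)"] D(1) that by simp
  qed
  moreover have "C1_on S (\<lambda>z. Blinfun L o\<^sub>L D z)"
    by (rule C1_on_bounded_linear[where f = D,
          OF bounded_bilinear.bounded_linear_right[OF bounded_bilinear_blinfun_compose] D(2)])
  ultimately show ?thesis unfolding C2_on_def by (intro exI[of _ "\<lambda>z. Blinfun L o\<^sub>L D z"]) auto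
qed

lemma C2_on_imp_C1_on: "C2_on S f \<Longrightarrow> C1_on S f"
  unfolding C2_on_def C1_on_def[of S f] using C1_on_imp_continuous_on[of S] by auto

text \<open>Evaluation at a basis vector is bounded linear on the space of operators, so it carries
  the C1 derivative field to a C1 function. Two applications of differentiation thus make sense of
  \<open>laplacian\<close>.\<close>

lemma C1_on_partial_deriv:
  fixes f :: "real^'d \<Rightarrow> 'b::real_normed_vector"
  assumes "open S" "C2_on S f"
  shows "C1_on S (partial_deriv j f)"
proof -
  obtain D where D: "\<forall>z\<in>S. (f has_derivative blinfun_apply (D z)) (at z within S)" "C1_on S D"
    using assms(2) unfolding C2_on_def by blast
  have "C1_on S (\<lambda>z. D z (axis j 1))"
    by (rule C1_on_bounded_linear[where f = D,
          OF bounded_bilinear.bounded_linear_left[OF bounded_bilinear_blinfun_apply] D(2)])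
  moreover have "D z (axis j 1) = partial_deriv j f z" if "z \<in> S" for z
    unfolding partial_deriv_def using D(1) assms(1) that
    by (metis at_within_open frechet_derivative_at)
  ultimately show ?thesis using C1_on_cong[of S "\<lambda>z. D z (axis j 1)" "partial_deriv j f"] by simp
qed

lemma continuous_on_partial_deriv:
  fixes f :: "real^'d \<Rightarrow> 'b::real_normed_vector"
  assumes "open S" "C1_on S f"
  shows "continuous_on S (partial_deriv j f)"
  using assms unfolding partial_deriv_def[abs_def] by (simp add: C1_on_open_iff)

section \<open>Truncated powers and a compactly supported bump\<close>

text \<open>Away from \<open>0\<close> the function is locally a power or zero. An exponent of at
  least 2 is what makes the two one-sided derivatives agree at \<open>0\<close>.\<close>

lemma has_field_derivative_max_0_power:
  "((\<lambda>s::real. max 0 s ^ Suc (Suc n)) has_field_derivative real (Suc (Suc n)) * max 0 s ^ Suc n) (at s)"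
proof -
  consider "s > 0" | "s < 0" | "s = 0" by linarith
  then show ?thesis
  proof cases
    case 1
    have "((\<lambda>s::real. s ^ Suc (Suc n)) has_field_derivative real (Suc (Suc n)) * s ^ Suc n) (at s)"
      using DERIV_power[OF DERIV_ident, of "Suc (Suc n)" s UNIV] by simp
    then have "((\<lambda>s::real. max 0 s ^ Suc (Suc n)) has_field_derivative real (Suc (Suc n)) * s ^ Suc n) (at s)"
      by (rule has_field_derivative_transform_within_open[where S = "{0<..}"]) (use 1 in auto)
    then show ?thesis using 1 by simp
  next
    case 2
    have "((\<lambda>s::real. 0) has_field_derivative 0) (at s)" by simp
    then have "((\<lambda>s::real. max 0 s ^ Suc (Suc n)) has_field_derivative 0) (at s)"
      by (rule has_field_derivative_transform_within_open[where S = "{..<0}"]) (use 2 in auto)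
    then show ?thesis using 2 by simp
  next
    case 3
    have "((\<lambda>h::real. max 0 h ^ Suc n) \<longlongrightarrow> max 0 0 ^ Suc n) (at 0)"
      by (intro tendsto_intros)
    then have "((\<lambda>h::real. max 0 h ^ Suc n) \<longlongrightarrow> 0) (at 0)" by simp
    \<comment> \<open>Dividing by \<open>h\<close> lowers the exponent by one, and the remaining
      exponent \<open>Suc n\<close> is still positive, so the quotient tends to
      \<open>0\<close>.\<close>
    moreover have "max 0 h ^ Suc n = (max 0 h ^ Suc (Suc n) - max 0 0 ^ Suc (Suc n)) / (h - 0)" if "h \<noteq> 0" for h :: real
      using that by (auto simp: max_def)
    ultimately have "((\<lambda>h::real. (max 0 h ^ Suc (Suc n) - max 0 0 ^ Suc (Suc n)) / (h - 0)) \<longlongrightarrow> 0) (at 0)"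
      by (metis (no_types, lifting) Lim_cong_within)
    then show ?thesis using 3 by (simp add: has_field_derivative_iff)
  qed
qed

lemma C1_on_max_0_power:
  fixes f :: "'a::real_normed_vector \<Rightarrow> real"
  assumes "C1_on S f"
  shows "C1_on S (\<lambda>x. max 0 (f x) ^ Suc (Suc n))"
proof -
  obtain D where D: "\<forall>z\<in>S. (f has_derivative blinfun_apply (D z)) (at z within S)" "continuous_on S D"
    using assms(1) unfolding C1_on_def by blast
  let ?D = "\<lambda>z. (real (Suc (Suc n)) * max 0 (f z) ^ Suc n) *\<^sub>R D z"
  have "((\<lambda>x. max 0 (f x) ^ Suc (Suc n)) has_derivative blinfun_apply (?D z)) (at z within S)"
    if "z \<in> S" for z
    using has_derivative_compose[OF D(1)[rule_format, OF that]
        has_field_derivative_max_0_power[of n "f z", unfolded has_field_derivative_def]]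
    by (simp add: scaleR_blinfun.rep_eq)
  moreover have "continuous_on S ?D"
    using D(2) C1_on_imp_continuous_on[OF assms] by (intro continuous_intros)
  ultimately show ?thesis unfolding C1_on_def by (intro exI[of _ ?D]) auto
qed

text \<open>The cube makes the truncated paraboloid twice continuously differentiable.\<close>

definition bump :: "'a::real_inner \<Rightarrow> real \<Rightarrow> 'a \<Rightarrow> real" where
  "bump z r x = max 0 (r\<^sup>2 - (x - z) \<bullet> (x - z)) ^ 3"

lemma bump_nonneg: "bump z r x \<ge> 0" by (simp add: bump_def)

lemma bump_pos:
  assumes "x \<in> ball z r" shows "bump z r x > 0"
proof -
  have "norm (x - z) < r" using assms by (simp add: dist_norm norm_minus_commute)
  then have "(norm (x - z))\<^sup>2 < r\<^sup>2" by (intro power_strict_mono) auto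
  then show ?thesis by (simp add: bump_def dot_square_norm)
qed

lemma bump_eq_0:
  assumes "x \<notin> ball z r" "r > 0" shows "bump z r x = 0"
proof -
  have "r \<le> norm (x - z)" using assms by (simp add: dist_norm norm_minus_commute)
  then have "r\<^sup>2 \<le> (norm (x - z))\<^sup>2" using assms(2) by (intro power_mono) auto
  then show ?thesis by (simp add: bump_def dot_square_norm)
qed

text \<open>The chain rule gives the derivative \<open>?D\<close>, a truncated square times an
  affine field. The square is the lowest truncated power that is still C1, so \<open>?D\<close> is
  C1.\<close>

lemma C2_on_bump: "C2_on S (bump z r)"
proof -
  let ?f = "\<lambda>x. r\<^sup>2 - (x - z) \<bullet> (x - z)"
  let ?L = "\<lambda>x. -2 *\<^sub>R blinfun_inner_left (x - z)"
  let ?D = "\<lambda>x. (3 * max 0 (?f x) ^ 2) *\<^sub>R ?L x"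
  have f: "(?f has_derivative blinfun_apply (?L x)) (at x within S)" for x
    by (auto intro!: derivative_eq_intros simp: scaleR_blinfun.rep_eq uminus_blinfun.rep_eq inner_commute)
  have L: "C1_on S ?L"
  proof -
    have "C1_on S (\<lambda>x. x - z)"
      unfolding C1_on_def by (rule exI[of _ "\<lambda>_. id_blinfun"]) (auto intro!: derivative_eq_intros)
    then show ?thesis
      by (rule C1_on_bounded_linear[where f = "\<lambda>x. x - z",
            OF bounded_linear_const_scaleR[OF bounded_linear_blinfun_inner_left]])
  qed
  have "C1_on S ?f" unfolding C1_on_def
    using f C1_on_imp_continuous_on[OF L] by (intro exI[of _ ?L]) auto
  then have "C1_on S (\<lambda>x. max 0 (?f x) ^ 2)"
    using C1_on_max_0_power[of S ?f 0] by (simp add: power2_eq_square)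
  then have "C1_on S (\<lambda>x. 3 * max 0 (?f x) ^ 2)"
    by (rule C1_on_bounded_linear[OF bounded_linear_mult_right])
  from C1_on_scaleR[OF this L] have "C1_on S ?D" .
  moreover have "(bump z r has_derivative blinfun_apply (?D x)) (at x within S)" for x
    using has_derivative_compose[OF f[of x]
        has_field_derivative_max_0_power[of 1 "?f x", unfolded has_field_derivative_def]]
    by (simp add: bump_def[abs_def] scaleR_blinfun.rep_eq uminus_blinfun.rep_eq mult.assoc
        power2_eq_square power3_eq_cube)
  ultimately show ?thesis unfolding C2_on_def by (intro exI[of _ ?D]) auto
qed

subsection \<open>Integration by parts and the fundamental lemma\<close>

lemma partial_deriv_eq_0:
  assumes "open U" "x \<in> U" "\<And>y. y \<in> U \<Longrightarrow> f y = 0"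
  shows "partial_deriv j f x = 0"
proof -
  have "(f has_derivative (\<lambda>h. 0)) (at x)"
    using has_derivative_const[of 0 "at x"]
    by (rule has_derivative_transform_within_open[where s = U]) (use assms in auto)
  then show ?thesis unfolding partial_deriv_def by (metis frechet_derivative_at)
qed

text \<open>Restriction to a coordinate line turns the partial derivative into a one-variable
  derivative, to which the mean value inequality and difference quotients apply.\<close>

lemma partial_deriv_vector_derivative:
  fixes f :: "real^'d \<Rightarrow> 'b::real_normed_vector"
  assumes "f differentiable (at (x + s *\<^sub>R axis j 1))"
  shows "((\<lambda>s. f (x + s *\<^sub>R axis j 1)) has_vector_derivative partial_deriv j f (x + s *\<^sub>R axis j 1)) (at s)"
proof -
  have f: "(f has_derivative frechet_derivative f (at (x + s *\<^sub>R axis j 1))) (at (x + s *\<^sub>R axis j 1))"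
    using assms frechet_derivative_works by blast
  have g: "((\<lambda>s. x + s *\<^sub>R axis j 1) has_derivative (\<lambda>h. h *\<^sub>R axis j (1::real))) (at s)"
    by (auto intro!: derivative_eq_intros)
  have "frechet_derivative f (at (x + s *\<^sub>R axis j 1)) (h *\<^sub>R axis j 1) = h *\<^sub>R partial_deriv j f (x + s *\<^sub>R axis j 1)" for h
    unfolding partial_deriv_def using has_derivative_linear[OF f] by (simp add: linear_scale)
  then show ?thesis
    using has_derivative_compose[OF g f] by (simp add: has_vector_derivative_def)
qed

lemma has_vector_derivative_quotient_tendsto:
  assumes "(f has_vector_derivative D) (at x)"
  shows "((\<lambda>h. (f (x + h) - f x) /\<^sub>R h) \<longlongrightarrow> D) (at 0)"
proof -
  have "((\<lambda>h. norm (f (x + h) - f x - h *\<^sub>R D) / norm h) \<longlongrightarrow> 0) (at 0)"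
    using assms by (simp add: has_vector_derivative_def has_derivative_at)
  moreover have "norm (f (x + h) - f x - h *\<^sub>R D) / norm h = norm ((f (x + h) - f x) /\<^sub>R h - D)"
    if "h \<noteq> 0" for h
  proof -
    have "(f (x + h) - f x) /\<^sub>R h - D = (f (x + h) - f x - h *\<^sub>R D) /\<^sub>R h"
      using that by (simp add: scaleR_diff_right)
    then show ?thesis by (simp add: divide_inverse mult.commute)
  qed
  then have "eventually (\<lambda>h. norm (f (x + h) - f x - h *\<^sub>R D) / norm h
      = norm ((f (x + h) - f x) /\<^sub>R h - D)) (at 0)"
    by (simp add: eventually_at_filter)
  ultimately have "((\<lambda>h. norm ((f (x + h) - f x) /\<^sub>R h - D)) \<longlongrightarrow> 0) (at 0)"
    by (rule Lim_transform_eventually)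
  then show ?thesis by (metis LIM_zero_cancel tendsto_norm_zero_cancel)
qed

text \<open>
  By translation invariance the difference quotients of \<open>f\<close> have integral \<open>0\<close>; they converge dominatedly.
\<close>

lemma integral_partial_deriv_eq_0:
  fixes f :: "real^'d \<Rightarrow> 'b::euclidean_space"
  assumes f: "C1_on UNIV f" and K: "compact K" and 0: "\<And>x. x \<notin> K \<Longrightarrow> f x = 0"
  shows "integrable lborel (partial_deriv j f)" "(LINT x|lborel. partial_deriv j f x) = 0"
proof -
  let ?e = "axis j (1::real) :: real^'d"
  let ?p = "partial_deriv j f"
  have cf: "continuous_on UNIV f" by (rule C1_on_imp_continuous_on[OF f])
  have cp: "continuous_on UNIV ?p" by (rule continuous_on_partial_deriv[OF open_UNIV f])
  have diff: "f differentiable (at x)" for x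
    using f C1_on_open_iff by blast
  have p0: "?p x = 0" if "x \<notin> K" for x
    using K that 0 compact_imp_closed by (intro partial_deriv_eq_0[of "- K"]) (auto simp: open_Compl)
  have "bounded (?p ` K)"
    using K cp by (intro compact_imp_bounded compact_continuous_image) (auto intro: continuous_on_subset)
  then obtain B where B: "B > 0" "\<And>x. x \<in> K \<Longrightarrow> norm (?p x) \<le> B"
    unfolding bounded_pos by auto
  have B': "norm (?p x) \<le> B" for x using B p0[of x] by (cases "x \<in> K") auto
  obtain R where R: "R > 0" "\<And>x. x \<in> K \<Longrightarrow> norm x \<le> R"
    using compact_imp_bounded[OF K] unfolding bounded_pos by auto
  have int: "integrable lborel g" if "continuous_on UNIV g" "\<And>x. x \<notin> K \<Longrightarrow> g x = 0" for g :: "real^'d \<Rightarrow> 'b"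
  proof -
    have "integrable lborel (\<lambda>x. indicator K x *\<^sub>R g x)"
      using K that(1) by (intro borel_integrable_compact) (auto intro: continuous_on_subset)
    moreover have "indicator K x *\<^sub>R g x = g x" for x using that(2) by (auto simp: indicator_def)
    ultimately show ?thesis by simp
  qed
  show "integrable lborel ?p" by (rule int[OF cp p0])
  let ?s = "\<lambda>n. inverse (real (Suc n))"
  let ?q = "\<lambda>n x. (1 / ?s n) *\<^sub>R (f (x + ?s n *\<^sub>R ?e) - f x)"
  \<comment> \<open>By the mean value inequality the bound \<open>B\<close> on the partial
    derivative bounds every difference quotient, uniformly in \<open>n\<close>.\<close>
  have lip: "norm (f (x + s *\<^sub>R ?e) - f x) \<le> B * s" if "s \<ge> 0" for x s
  proof -
    let ?g = "\<lambda>s. f (x + s *\<^sub>R ?e)"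
    have "norm (?g s - ?g 0) \<le> B * norm (s - 0)"
    proof (rule differentiable_bound[of UNIV ?g "\<lambda>s h. h *\<^sub>R ?p (x + s *\<^sub>R ?e)"])
      fix t show "(?g has_derivative (\<lambda>h. h *\<^sub>R ?p (x + t *\<^sub>R ?e))) (at t)"
        using partial_deriv_vector_derivative[OF diff] by (simp add: has_vector_derivative_def)
      show "onorm (\<lambda>h. h *\<^sub>R ?p (x + t *\<^sub>R ?e)) \<le> B"
        using mult_left_mono[OF B'] by (intro onorm_le) (simp add: mult.commute[of B])
    qed auto
    then show ?thesis using that by simp
  qed
  have "(\<lambda>n. LINT x|lborel. ?q n x) \<longlonglongrightarrow> (LINT x|lborel. ?p x)"
  \<comment> \<open>The support lies in the ball of radius \<open>R\<close> and the step sizes are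
    at most 1, so all difference quotients vanish outside radius \<open>R + 1\<close>.\<close>
  proof (rule integral_dominated_convergence[where w = "\<lambda>x. B * indicator (cball 0 (R + 1)) x"])
    show "?p \<in> borel_measurable lborel"
      using borel_measurable_continuous_onI[OF cp] by simp
    show "?q n \<in> borel_measurable lborel" for n
    proof -
      have "continuous_on UNIV (?q n)"
        by (intro continuous_intros continuous_on_compose2[OF cf]) auto
      then show ?thesis by (simp add: borel_measurable_continuous_onI)
    qed
    show "integrable lborel (\<lambda>x. B * indicator (cball 0 (R + 1)) x)"
      by (intro integrable_mult_right integrable_real_indicator) (simp_all only: sets_lborel emeasure_lborel_cball_finite borel_closed closed_cball)
    show "AE x in lborel. (\<lambda>n. ?q n x) \<longlonglongrightarrow> ?p x"
    proof (intro AE_I2)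
      fix x
      have "((\<lambda>s. f (x + s *\<^sub>R ?e)) has_vector_derivative ?p x) (at 0)"
        using partial_deriv_vector_derivative[where x = x and s = 0 and j = j, OF diff] by simp
      from has_vector_derivative_quotient_tendsto[OF this]
      have "((\<lambda>s. (f (x + s *\<^sub>R ?e) - f x) /\<^sub>R s) \<longlongrightarrow> ?p x) (at 0)" by simp
      moreover have "filterlim ?s (at 0) sequentially"
        unfolding filterlim_at using LIMSEQ_inverse_real_of_nat by auto
      ultimately have "(\<lambda>n. (f (x + ?s n *\<^sub>R ?e) - f x) /\<^sub>R ?s n) \<longlonglongrightarrow> ?p x"
        by (rule filterlim_compose)
      then show "(\<lambda>n. ?q n x) \<longlonglongrightarrow> ?p x" by (simp add: divide_inverse)
    qed
    show "AE x in lborel. norm (?q n x) \<le> B * indicator (cball 0 (R + 1)) x" for n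
    proof (intro AE_I2)
      fix x
      have s: "0 < ?s n" "?s n \<le> 1" by (auto simp: field_simps)
      show "norm (?q n x) \<le> B * indicator (cball 0 (R + 1)) x"
      proof (cases "x \<in> cball 0 (R + 1)")
        case True
        have "norm (?q n x) \<le> (1 / ?s n) * (B * ?s n)"
          using lip[of "?s n" x] s by (simp only: norm_scaleR) (intro mult_mono; simp)
        also have "\<dots> = B" using s by simp
        finally show ?thesis using True by simp
      next
        case False
        then have n: "norm x > R + 1" by simp
        then have "x \<notin> K" using R(2)[of x] by force
        moreover have "norm (x + ?s n *\<^sub>R ?e) \<ge> norm x - ?s n"
          using norm_diff_ineq[of x "?s n *\<^sub>R ?e"] s by (simp add: norm_axis_1)
        then have "x + ?s n *\<^sub>R ?e \<notin> K" using R(2)[of "x + ?s n *\<^sub>R ?e"] n s by linarith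
        ultimately show ?thesis using 0 B(1) by simp
      qed
    qed
  qed
  moreover have "(LINT x|lborel. ?q n x) = 0" for n
  proof -
    have i: "integrable lborel f" using cf 0 by (rule int)
    have "integrable (distr lborel borel ((+) (?s n *\<^sub>R ?e))) f" using i by (simp only: lborel_distr_plus)
    then have i': "integrable lborel (\<lambda>x. f (?s n *\<^sub>R ?e + x))"
      by (subst (asm) integrable_distr_eq) (use cf in \<open>auto simp: borel_measurable_continuous_onI\<close>)
    have "(LINT x|lborel. f (?s n *\<^sub>R ?e + x)) = (LINT x|distr lborel borel ((+) (?s n *\<^sub>R ?e)). f x)"
      by (rule integral_distr[symmetric]) (use cf in \<open>auto simp: borel_measurable_continuous_onI\<close>)
    also have "\<dots> = (LINT x|lborel. f x)" by (simp only: lborel_distr_plus)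
    finally show ?thesis
      using i i' by (simp add: add.commute)
  qed
  ultimately show "(LINT x|lborel. ?p x) = 0"
    by (simp add: LIMSEQ_const_iff)
qed

text \<open>If \<open>F z > 0\<close>, then \<open>F\<close> is positive on a small closed ball
  around \<open>z\<close>. The bump of that radius is positive exactly on the open ball, so the
  integral could not vanish. Only bumps centred at the point in question are tested.\<close>

lemma fundamental_lemma_bump:
  fixes F :: "'a::euclidean_space \<Rightarrow> real"
  assumes S: "open S" "z \<in> S" and F: "continuous_on S F"
    and 0: "\<And>r. 0 < r \<Longrightarrow> cball z r \<subseteq> S \<Longrightarrow> (LINT x:S|lborel. bump z r x * F x) = 0"
  shows "F z = 0"
proof -
  have pos: False if F: "continuous_on S F" and Fz: "F z > 0"
    and 0: "\<And>r. 0 < r \<Longrightarrow> cball z r \<subseteq> S \<Longrightarrow> (LINT x:S|lborel. bump z r x * F x) = 0"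
    for F :: "'a \<Rightarrow> real"
  proof -
    have "open (F -` {0<..} \<inter> S)"
      using continuous_open_preimage[OF F S(1), of "{0<..}"] by (simp add: Int_commute)
    then obtain r where r: "r > 0" "cball z r \<subseteq> F -` {0<..} \<inter> S"
      using Fz S(2) by (metis IntI open_contains_cball greaterThan_iff vimage_eq)
    let ?g = "\<lambda>x. indicator S x *\<^sub>R (bump z r x * F x)"
    have eq: "?g = (\<lambda>x. indicator (cball z r) x *\<^sub>R (bump z r x * F x))"
    proof
      fix x show "?g x = indicator (cball z r) x *\<^sub>R (bump z r x * F x)"
        using r bump_eq_0[of x z r] by (auto simp: indicator_def)
    qed
    have "continuous_on (cball z r) (\<lambda>x. bump z r x * F x)"
      using r(2) F C1_on_imp_continuous_on[OF C2_on_imp_C1_on[OF C2_on_bump]]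
      by (intro continuous_intros) (auto intro: continuous_on_subset)
    \<comment> \<open>A Bochner integral also equals \<open>0\<close> when the integrand fails to be
      integrable, so integrability must be known before a zero integral says anything. Compact
      support supplies it.\<close>
    then have int: "integrable lborel ?g" unfolding eq
      by (intro borel_integrable_compact) auto
    have nonneg: "?g x \<ge> 0" for x
      unfolding fun_cong[OF eq, of x] using r(2) bump_nonneg[of z r x] by (auto simp: indicator_def intro: less_imp_le)
    have "(LINT x|lborel. ?g x) = 0"
      using 0[of r] r unfolding set_lebesgue_integral_def by auto
    then have "AE x in lborel. ?g x = 0"
      using integral_nonneg_eq_0_iff_AE[OF int] nonneg by auto
    then have "AE x in lborel. x \<notin> ball z r"
    proof eventually_elim
      case (elim x)
      show ?case
      proof
        assume x: "x \<in> ball z r"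
        then have "x \<in> cball z r" by simp
        then have "F x > 0" "x \<in> S" using r(2) by blast+
        then show False using bump_pos[OF x] elim by simp
      qed
    qed
    then have "emeasure lborel (ball z r) = 0"
      by (subst (asm) AE_iff_measurable[of "ball z r"]) auto
    moreover have "emeasure lborel (ball z r) > 0"
      using r(1) by (simp add: emeasure_ball)
    ultimately show False by simp
  qed
  have "\<not> F z > 0" using pos[OF F _ 0] by auto
  moreover have "\<not> - F z > 0"
  proof
    assume "- F z > 0"
    moreover have "(LINT x:S|lborel. bump z r x * - F x) = 0" if "0 < r" "cball z r \<subseteq> S" for r
      using 0[OF that] by (simp add: set_lebesgue_integral_def)
    ultimately show False using pos[OF continuous_on_minus[OF F]] by simp
  qed
  ultimately show ?thesis by simp
qed

text \<open>For small \<open>s\<close> of sign opposite to \<open>L\<close> the linear term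
  dominates and is negative.\<close>

lemma linear_coeff_eq_0:
  fixes L M :: real
  assumes "\<And>s. 0 \<le> s * L + s\<^sup>2 * M"
  shows "L = 0"
proof (rule ccontr)
  assume L: "L \<noteq> 0"
  obtain c where c: "c > 0" "M < c" using gt_ex[of "max 0 M"] by auto
  \<comment> \<open>With \<open>c > M\<close> the choice \<open>s = - L / c\<close> is small enough
    for the linear term to win.\<close>
  have "0 \<le> (- L / c) * L + (- L / c)\<^sup>2 * M" by (rule assms)
  also have "\<dots> = (L / c)\<^sup>2 * (M - c)"
    using c(1) by (simp add: field_simps power2_eq_square)
  also have "\<dots> < 0"
    using L c by (intro mult_pos_neg) auto
  finally show False by simp
qed

text \<open>The energies live in \<open>ennreal\<close>, where nothing can be subtracted. Finiteness
  makes \<open>e\<close> integrable, so each perturbed energy is a real quadratic polynomial in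
  \<open>s\<close> whose minimum lies at \<open>0\<close>.\<close>

lemma first_variation_eq_0:
  fixes e l m :: "'a::euclidean_space \<Rightarrow> real"
  assumes S: "S \<in> sets lborel"
    and e: "set_borel_measurable lborel S e"
    and l: "set_integrable lborel S l" and m: "set_integrable lborel S m"
    and nonneg: "\<And>s x. x \<in> S \<Longrightarrow> 0 \<le> e x + s * l x + s\<^sup>2 * m x"
    and fin: "(\<integral>\<^sup>+x\<in>S. ennreal (e x) \<partial>lborel) < \<infinity>"
    and min: "\<And>s. (\<integral>\<^sup>+x\<in>S. ennreal (e x) \<partial>lborel) \<le> (\<integral>\<^sup>+x\<in>S. ennreal (e x + s * l x + s\<^sup>2 * m x) \<partial>lborel)"
  shows "(LINT x:S|lborel. l x) = 0"
proof -
  have nn: "(\<integral>\<^sup>+x\<in>S. ennreal (g x) \<partial>lborel) = (\<integral>\<^sup>+x. ennreal (indicator S x *\<^sub>R g x) \<partial>lborel)" for g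
    by (intro nn_integral_cong) (auto simp: indicator_def)
  have e0: "e x \<ge> 0" if "x \<in> S" for x using nonneg[OF that, of 0] by simp
  have ei: "set_integrable lborel S e"
    using e fin e0 unfolding nn set_integrable_def set_borel_measurable_def
    by (intro integrableI_nonneg) (auto simp: indicator_def)
  let ?E = "LINT x:S|lborel. e x" and ?L = "LINT x:S|lborel. l x" and ?M = "LINT x:S|lborel. m x"
  have val: "(\<integral>\<^sup>+x\<in>S. ennreal (e x + s * l x + s\<^sup>2 * m x) \<partial>lborel) = ennreal (?E + s * ?L + s\<^sup>2 * ?M)"
    "0 \<le> ?E + s * ?L + s\<^sup>2 * ?M" for s
  proof -
    have i: "set_integrable lborel S (\<lambda>x. e x + s * l x + s\<^sup>2 * m x)"
      using ei l m by (intro set_integral_add set_integrable_mult_right) auto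
    have n: "0 \<le> indicator S x *\<^sub>R (e x + s * l x + s\<^sup>2 * m x)" for x
      using nonneg[of x s] by (auto simp: indicator_def)
    have v: "(LINT x:S|lborel. e x + s * l x + s\<^sup>2 * m x) = ?E + s * ?L + s\<^sup>2 * ?M"
      using ei l m by (simp add: set_integral_add set_integrable_mult_right)
    show "(\<integral>\<^sup>+x\<in>S. ennreal (e x + s * l x + s\<^sup>2 * m x) \<partial>lborel) = ennreal (?E + s * ?L + s\<^sup>2 * ?M)"
      unfolding nn v[symmetric]
      using i n unfolding set_lebesgue_integral_def set_integrable_def by (intro nn_integral_eq_integral) auto
    show "0 \<le> ?E + s * ?L + s\<^sup>2 * ?M"
      unfolding v[symmetric] using n unfolding set_lebesgue_integral_def
      by (intro Bochner_Integration.integral_nonneg) auto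
  qed
  \<comment> \<open>The case \<open>s = 0\<close> evaluates the unperturbed energy. Nonnegativity of
    the values matters because \<open>ennreal\<close> sends negative reals to
    \<open>0\<close>.\<close>
  have ineq: "0 \<le> s * ?L + s\<^sup>2 * ?M" for s
    using min[of s] val(1)[of s] val(1)[of 0] val(2)[of s] val(2)[of 0] by (simp add: ennreal_le_iff)
  then show ?thesis by (rule linear_coeff_eq_0)
qed

subsection \<open>Time integrals\<close>

text \<open>Restricting the joint derivative to slices shows that the gradient is read off from
  \<open>D (t, x) (0, h)\<close> and the time derivative is \<open>D (t, x) (1, 0)\<close>. The
  space variable comes first because it is the parameter in the later integrals over time.\<close>

lemma C1_on_time_space:
  fixes F :: "real \<Rightarrow> real^'d \<Rightarrow> real"
  assumes T: "T > 0" and S: "open \<Omega>" and F: "C1_on ({0..T} \<times> \<Omega>) (\<lambda>(t, x). F t x)"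
  shows "continuous_on (\<Omega> \<times> {0..T}) (\<lambda>z. grad (F (snd z)) (fst z))"
    and "continuous_on (\<Omega> \<times> {0..T}) (\<lambda>z. time_deriv T F (snd z) (fst z))"
proof -
  obtain D where D: "\<forall>z\<in>{0..T} \<times> \<Omega>. ((\<lambda>(t, x). F t x) has_derivative blinfun_apply (D z)) (at z within {0..T} \<times> \<Omega>)"
      "continuous_on ({0..T} \<times> \<Omega>) D"
    using F unfolding C1_on_def by blast
  have cD: "continuous_on (\<Omega> \<times> {0..T}) (\<lambda>z. D (snd z, fst z))"
    by (intro continuous_on_compose2[OF D(2)] continuous_intros) auto
  have x: "frechet_derivative (F t) (at x) = (\<lambda>h. D (t, x) (0, h))" if "t \<in> {0..T}" "x \<in> \<Omega>" for t x
  proof -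
    have "((\<lambda>(t, x). F t x) has_derivative blinfun_apply (D (t, x))) (at (t, x) within Pair t ` \<Omega>)"
      by (rule has_derivative_subset[OF D(1)[rule_format]]) (use that in auto)
    moreover have "(Pair t has_derivative (\<lambda>h. (0, h))) (at x within \<Omega>)"
      by (auto intro!: derivative_eq_intros)
    ultimately have "(F t has_derivative (\<lambda>h. D (t, x) (0, h))) (at x within \<Omega>)"
      using has_derivative_in_compose[of "Pair t" "\<lambda>h. (0, h)" x \<Omega> "\<lambda>(t, x). F t x" "D (t, x)"] by simp
    then show ?thesis using at_within_open[OF that(2) S] frechet_derivative_at[of "F t" _ x] by simp
  qed
  have t: "time_deriv T F t x = D (t, x) (1, 0)" if "t \<in> {0..T}" "x \<in> \<Omega>" for t x
  proof -
    let ?p = "\<lambda>t. (t, x)"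
    have "((\<lambda>(t, x). F t x) has_derivative blinfun_apply (D (t, x))) (at (t, x) within ?p ` {0..T})"
      by (rule has_derivative_subset[OF D(1)[rule_format]]) (use that in auto)
    moreover have "(?p has_derivative (\<lambda>h. (h, 0))) (at t within {0..T})"
      by (auto intro!: derivative_eq_intros)
    ultimately have "((\<lambda>t. F t x) has_derivative (\<lambda>h. D (t, x) (h, 0))) (at t within {0..T})"
      using has_derivative_in_compose[of ?p "\<lambda>h. (h, 0)" t "{0..T}" "\<lambda>(t, x). F t x" "D (t, x)"] by simp
    moreover have "(\<lambda>h. D (t, x) (h, 0)) = (\<lambda>h. h *\<^sub>R D (t, x) (1, 0))"
    proof
      show "D (t, x) (h, 0) = h *\<^sub>R D (t, x) (1, 0)" for h
        using blinfun.scaleR_right[of "D (t, x)" h "(1, 0)"] by simp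
    qed
    ultimately have "((\<lambda>t. F t x) has_vector_derivative D (t, x) (1, 0)) (at t within {0..T})"
      unfolding has_vector_derivative_def by (simp only:)
    \<comment> \<open>Since \<open>T > 0\<close>, the interval is nondegenerate and the derivative
      within it is unique, also at its end points.\<close>
    then show ?thesis unfolding time_deriv_def
      using T that(1) vector_derivative_within_cbox[of 0 T t "\<lambda>t. F t x"] by simp
  qed
  have "continuous_on (\<Omega> \<times> {0..T}) (\<lambda>z. \<chi> k. D (snd z, fst z) (0, axis k 1))"
    using cD by (intro continuous_intros)
  then show "continuous_on (\<Omega> \<times> {0..T}) (\<lambda>z. grad (F (snd z)) (fst z))"
    by (rule continuous_on_eq) (auto simp: x grad_def partial_deriv_def)
  have "continuous_on (\<Omega> \<times> {0..T}) (\<lambda>z. D (snd z, fst z) (1, 0))"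
    using cD by (intro continuous_intros)
  then show "continuous_on (\<Omega> \<times> {0..T}) (\<lambda>z. time_deriv T F (snd z) (fst z))"
    by (rule continuous_on_eq) (auto simp: t)
qed

lemma continuous_on_param_slice:
  assumes "continuous_on (S \<times> R) (\<lambda>z. f (fst z) (snd z))" "x \<in> S"
  shows "continuous_on R (f x)"
proof -
  have "continuous_on R (\<lambda>t. f (fst (x, t)) (snd (x, t)))"
    using assms(2) by (intro continuous_on_compose2[OF assms(1)] continuous_intros) auto
  then show ?thesis by simp
qed

lemma continuous_on_param_integral:
  fixes f :: "'a::topological_space \<Rightarrow> real \<Rightarrow> 'b::banach"
  assumes "continuous_on (S \<times> {a..b}) (\<lambda>z. f (fst z) (snd z))"
  shows "continuous_on S (\<lambda>x. integral {a..b} (f x))"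
  using integral_continuous_on_param[of S a b f] assms by (simp add: case_prod_unfold)

lemma set_integrable_lborel_interval:
  fixes f :: "real \<Rightarrow> 'b::{banach, second_countable_topology}"
  assumes "continuous_on {a..b} f"
  shows "set_integrable lborel {a..b} f"
  using borel_integrable_compact[OF compact_Icc assms] by (simp add: set_integrable_def)

text \<open>This rewrites the inner integral of \<open>energy\<close> as a gauge integral, for which
  continuity in a parameter is available.\<close>

lemma set_nn_integral_eq_integral:
  fixes f :: "real \<Rightarrow> real"
  assumes "continuous_on {a..b} f" "\<And>t. t \<in> {a..b} \<Longrightarrow> f t \<ge> 0"
  shows "(\<integral>\<^sup>+t\<in>{a..b}. ennreal (f t) \<partial>lborel) = ennreal (integral {a..b} f)"
proof -
  have i: "set_integrable lborel {a..b} f" by (rule set_integrable_lborel_interval[OF assms(1)])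
  have "(\<integral>\<^sup>+t\<in>{a..b}. ennreal (f t) \<partial>lborel) = (\<integral>\<^sup>+t. ennreal (indicator {a..b} t *\<^sub>R f t) \<partial>lborel)"
    by (intro nn_integral_cong) (auto simp: indicator_def)
  also have "\<dots> = ennreal (LINT t:{a..b}|lborel. f t)"
    unfolding set_lebesgue_integral_def using i assms(2) unfolding set_integrable_def
    by (intro nn_integral_eq_integral) (auto simp: indicator_def)
  also have "(LINT t:{a..b}|lborel. f t) = integral {a..b} f"
    by (rule set_borel_integral_eq_integral(2)[OF i])
  finally show ?thesis .
qed

lemma fourier_eq_integral:
  assumes "continuous_on {0..T} (\<lambda>t. f t x)"
  shows "fourier T f \<nu> x = integral {0..T} (\<lambda>t. of_real (f t x) * exp (- (\<i> * of_real (t * \<nu>))))"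
  unfolding fourier_def using assms
  by (intro set_borel_integral_eq_integral(2) set_integrable_lborel_interval continuous_intros)

lemma q_nonneg: "\<epsilon> > 0 \<Longrightarrow> q \<epsilon> x z \<ge> 0"
  by (auto simp: q_def)

lemma q_add:
  assumes "\<epsilon> > 0"
  shows "q \<epsilon> (x + s * y) z = q \<epsilon> x z + s * (x * y / max \<epsilon> \<bar>z\<bar>) + s\<^sup>2 * (y\<^sup>2 / (2 * max \<epsilon> \<bar>z\<bar>))"
proof -
  have "max \<epsilon> \<bar>z\<bar> > 0" using assms by simp
  then show ?thesis unfolding q_def
    by (simp add: power2_eq_square add_divide_distrib[symmetric] field_simps)
qed

abbreviation osc :: "real \<Rightarrow> real \<Rightarrow> complex" where
  "osc \<omega> t \<equiv> exp (\<i> * of_real (\<omega> * t))"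

text \<open>A product of real parts is the mean of \<open>Re (z * w)\<close> and
  \<open>Re (z * cnj w)\<close>. The first oscillates at frequency \<open>2 * \<omega>\<close> and
  integrates to zero over whole periods; the second is constant in time.\<close>

lemma integral_Re_osc_mult:
  assumes "\<omega> \<noteq> 0" "T = 2 * pi * real p / \<omega>" "T > 0"
  shows "integral {0..T} (\<lambda>t. Re (A * osc \<omega> t) * Re (B * osc \<omega> t)) = T / 2 * Re (A * cnj B)"
proof -
  \<comment> \<open>\<open>F\<close> is an antiderivative of the part of frequency
    \<open>2 * \<omega>\<close>.\<close>
  define F where "F t = A * B / (2 * \<i> * of_real \<omega>) * exp (2 * \<i> * of_real (\<omega> * t))" for t
  have F: "(F has_vector_derivative A * B * exp (2 * \<i> * of_real (\<omega> * t))) (at t within {0..T})" for t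
  proof -
    have "((\<lambda>z. A * B / (2 * \<i> * of_real \<omega>) * exp (2 * \<i> * (of_real \<omega> * z))) has_field_derivative
        A * B * exp (2 * \<i> * (of_real \<omega> * of_real t))) (at (of_real t))"
      using assms(1) by (auto intro!: derivative_eq_intros simp: field_simps)
    then show ?thesis
      unfolding F_def of_real_mult
      by (intro has_vector_derivative_real_field has_vector_derivative_at_within)
  qed
  have "exp (2 * \<i> * of_real (\<omega> * T)) = 1"
  proof -
    have "\<omega> * T = 2 * pi * real p" using assms by simp
    then have "2 * \<i> * complex_of_real (\<omega> * T) = of_real (2 * real (2 * p) * pi) * \<i>" by simp
    then show ?thesis using exp_integer_2pi[of "real (2 * p)"] by (simp only: Ints_of_nat)
  qed
  then have "F T - F 0 = 0" by (simp add: F_def)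
  then have "((\<lambda>t. A * B * exp (2 * \<i> * of_real (\<omega> * t))) has_integral 0) {0..T}"
    using fundamental_theorem_of_calculus[of 0 T F, OF _ F] assms(3) by simp
  then have "((\<lambda>t. Re (A * B * exp (2 * \<i> * of_real (\<omega> * t)))) has_integral 0) {0..T}"
    by (drule_tac has_integral_linear[OF _ bounded_linear_Re]) (simp add: o_def)
  moreover have "((\<lambda>t. Re (A * cnj B)) has_integral T * Re (A * cnj B)) {0..T}"
    using has_integral_const_real[of "Re (A * cnj B)" 0 T] assms(3) by simp
  ultimately have "((\<lambda>t. (Re (A * B * exp (2 * \<i> * of_real (\<omega> * t))) + Re (A * cnj B)) / 2)
      has_integral (0 + T * Re (A * cnj B)) / 2) {0..T}"
    by (rule has_integral_divide[OF has_integral_add])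
  moreover have "Re (A * osc \<omega> t) * Re (B * osc \<omega> t)
      = (Re (A * B * exp (2 * \<i> * of_real (\<omega> * t))) + Re (A * cnj B)) / 2" for t
  proof -
    let ?e = "osc \<omega> t"
    have "Re z * Re w = (Re (z * w) + Re (z * cnj w)) / 2" for z w :: complex by simp
    then have "Re (A * ?e) * Re (B * ?e) = (Re ((A * ?e) * (B * ?e)) + Re ((A * ?e) * cnj (B * ?e))) / 2" .
    moreover have "?e * ?e = exp (2 * \<i> * of_real (\<omega> * t))"
      unfolding mult_exp_exp by (rule arg_cong[of _ _ exp]) simp
    then have "(A * ?e) * (B * ?e) = A * B * exp (2 * \<i> * of_real (\<omega> * t))"
      by (metis mult.assoc mult.left_commute)
    moreover have "?e * cnj ?e = 1"
      by (simp add: exp_cnj mult_exp_exp)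
    then have "(A * ?e) * cnj (B * ?e) = A * cnj B"
      by (simp add: mult.assoc mult.left_commute[of ?e])
    ultimately show ?thesis by presburger
  qed
  ultimately have "((\<lambda>t. Re (A * osc \<omega> t) * Re (B * osc \<omega> t)) has_integral (0 + T * Re (A * cnj B)) / 2) {0..T}"
    by (simp only:)
  then show ?thesis using integral_unique by (simp only: add_0 times_divide_eq_left)
qed

subsection \<open>First variation of the energy\<close>

lemma harmonic_flow_add_scaleR:
  "harmonic_flow \<omega> (\<lambda>x. a x + s *\<^sub>R b x) t x = harmonic_flow \<omega> a t x + s *\<^sub>R harmonic_flow \<omega> b t x"
  by (simp add: harmonic_flow_def vec_eq_iff distrib_right)

lemma partial_deriv_add_scaleR:
  assumes "a differentiable (at x)" "b differentiable (at x)"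
  shows "partial_deriv j (\<lambda>x. a x + s *\<^sub>R b x) x = partial_deriv j a x + s *\<^sub>R partial_deriv j b x"
proof -
  have "((\<lambda>x. a x + s *\<^sub>R b x) has_derivative
      (\<lambda>h. frechet_derivative a (at x) h + s *\<^sub>R frechet_derivative b (at x) h)) (at x)"
    using assms by (intro has_derivative_add has_derivative_scaleR_right) (simp_all add: frechet_derivative_works)
  from frechet_derivative_at[OF this] show ?thesis unfolding partial_deriv_def by metis
qed

text \<open>For fixed \<open>t\<close> the passage from amplitude to flow is real linear, so it
  commutes with spatial differentiation.\<close>

lemma jacobian_harmonic_flow:
  assumes "a differentiable (at x)"
  shows "jacobian (harmonic_flow \<omega> a t) (at x) = (\<chi> k j. Re (partial_deriv j a x $ k * osc \<omega> t))"
proof -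
  let ?L = "\<lambda>z :: complex^'d. (\<chi> k. Re (z $ k * osc \<omega> t)) :: real^'d"
  have "linear ?L"
    by (rule linearI) (simp_all add: vec_eq_iff distrib_right)
  then have "bounded_linear ?L" by (simp add: linear_conv_bounded_linear)
  moreover have "(a has_derivative frechet_derivative a (at x)) (at x)"
    using assms by (simp add: frechet_derivative_works)
  ultimately have "((\<lambda>y. ?L (a y)) has_derivative (\<lambda>h. ?L (frechet_derivative a (at x) h))) (at x)"
    by (rule bounded_linear.has_derivative)
  then have "(harmonic_flow \<omega> a t has_derivative (\<lambda>h. ?L (frechet_derivative a (at x) h))) (at x)"
    by (simp add: harmonic_flow_def[abs_def])
  from frechet_derivative_at[OF this, symmetric] show ?thesis
    by (simp add: jacobian_def matrix_def partial_deriv_def)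
qed

text \<open>The point precedes the time here, so that partial application yields the function of
  time to be integrated first.\<close>

definition energy_density :: "real \<Rightarrow> real \<Rightarrow> real \<Rightarrow> (real \<Rightarrow> real^'d \<Rightarrow> real) \<Rightarrow> (real \<Rightarrow> real^'d \<Rightarrow> real^'d)
    \<Rightarrow> (real \<Rightarrow> real^'d \<Rightarrow> real^'d) \<Rightarrow> real^'d \<Rightarrow> real \<Rightarrow> real" where
  "energy_density \<epsilon> lam T I u v x t =
     q \<epsilon> (G T I v t x) (G T I u t x) + lam * (norm (jacobian (v t) (at x)))\<^sup>2"

text \<open>This and \<open>energy_density_var2\<close> are the coefficients of \<open>s\<close> and
  \<open>s\<^sup>2\<close> in the density along \<open>v + s h\<close>. In \<open>G\<close> only the
  gradient term sees \<open>h\<close>, since the time derivative of \<open>I\<close>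
  cancels.\<close>

definition energy_density_var1 :: "real \<Rightarrow> real \<Rightarrow> real \<Rightarrow> (real \<Rightarrow> real^'d \<Rightarrow> real) \<Rightarrow> (real \<Rightarrow> real^'d \<Rightarrow> real^'d)
    \<Rightarrow> (real \<Rightarrow> real^'d \<Rightarrow> real^'d) \<Rightarrow> (real \<Rightarrow> real^'d \<Rightarrow> real^'d) \<Rightarrow> real^'d \<Rightarrow> real \<Rightarrow> real" where
  "energy_density_var1 \<epsilon> lam T I u v h x t =
     w_D \<epsilon> T I u t x * G T I v t x * (grad (I t) x \<bullet> h t x)
     + 2 * lam * (jacobian (v t) (at x) \<bullet> jacobian (h t) (at x))"

definition energy_density_var2 :: "real \<Rightarrow> real \<Rightarrow> real \<Rightarrow> (real \<Rightarrow> real^'d \<Rightarrow> real) \<Rightarrow> (real \<Rightarrow> real^'d \<Rightarrow> real^'d)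
    \<Rightarrow> (real \<Rightarrow> real^'d \<Rightarrow> real^'d) \<Rightarrow> real^'d \<Rightarrow> real \<Rightarrow> real" where
  "energy_density_var2 \<epsilon> lam T I u h x t =
     w_D \<epsilon> T I u t x / 2 * (grad (I t) x \<bullet> h t x)\<^sup>2 + lam * (norm (jacobian (h t) (at x)))\<^sup>2"

lemma energy_density_nonneg: "\<epsilon> > 0 \<Longrightarrow> lam > 0 \<Longrightarrow> energy_density \<epsilon> lam T I u v x t \<ge> 0"
  by (simp add: energy_density_def q_nonneg)

text \<open>\<open>G\<close> is affine and the Jacobian linear in the flow, while the weight depends
  on \<open>u\<close> alone; hence the expansion is exact, without remainder.\<close>

lemma energy_density_add_scaleR:
  assumes "\<epsilon> > 0" "a differentiable (at x)" "b differentiable (at x)"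
  shows "energy_density \<epsilon> lam T I u (harmonic_flow \<omega> (\<lambda>x. a x + s *\<^sub>R b x)) x t =
    energy_density \<epsilon> lam T I u (harmonic_flow \<omega> a) x t
    + s * energy_density_var1 \<epsilon> lam T I u (harmonic_flow \<omega> a) (harmonic_flow \<omega> b) x t
    + s\<^sup>2 * energy_density_var2 \<epsilon> lam T I u (harmonic_flow \<omega> b) x t"
proof -
  let ?v = "harmonic_flow \<omega> a" and ?h = "harmonic_flow \<omega> b"
  let ?c = "harmonic_flow \<omega> (\<lambda>x. a x + s *\<^sub>R b x)"
  let ?g = "grad (I t) x \<bullet> ?h t x"
  let ?J = "jacobian (?v t) (at x)" and ?H = "jacobian (?h t) (at x)"
  have "(\<lambda>x. a x + s *\<^sub>R b x) differentiable (at x)" using assms(2,3) by simp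
  then have J: "jacobian (?c t) (at x) = ?J + s *\<^sub>R ?H"
    using assms(2,3)
    by (simp add: jacobian_harmonic_flow partial_deriv_add_scaleR vec_eq_iff distrib_right)
  have "(norm (?J + s *\<^sub>R ?H))\<^sup>2 = (norm ?J)\<^sup>2 + s * (2 * (?J \<bullet> ?H)) + s\<^sup>2 * (norm ?H)\<^sup>2"
    unfolding power2_norm_eq_inner
    by (simp add: inner_add_left inner_add_right inner_commute power2_eq_square algebra_simps)
  moreover have "G T I ?c t x = G T I ?v t x + s * ?g"
    by (simp add: G_def harmonic_flow_add_scaleR inner_add_right)
  ultimately show ?thesis
    unfolding energy_density_def energy_density_var1_def energy_density_var2_def J w_D_def
    by (simp add: q_add[OF assms(1)] algebra_simps)
qed

lemma energy_eq_integral: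
  assumes "\<epsilon> > 0" "lam > 0" "\<And>x. x \<in> \<Omega> \<Longrightarrow> continuous_on {0..T} (energy_density \<epsilon> lam T I u v x)"
  shows "energy \<epsilon> lam T \<Omega> I u v = (\<integral>\<^sup>+x\<in>\<Omega>. ennreal (integral {0..T} (energy_density \<epsilon> lam T I u v x)) \<partial>lborel)"
  unfolding energy_def energy_density_def[symmetric]
proof (intro nn_integral_cong)
  fix x
  show "(\<integral>\<^sup>+t\<in>{0..T}. ennreal (energy_density \<epsilon> lam T I u v x t) \<partial>lborel) * indicator \<Omega> x
    = ennreal (integral {0..T} (energy_density \<epsilon> lam T I u v x)) * indicator \<Omega> x"
    using assms by (cases "x \<in> \<Omega>") (auto simp: set_nn_integral_eq_integral energy_density_nonneg)
qed

lemma continuous_on_harmonic_flow: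
  assumes "C1_on \<Omega> a"
  shows "continuous_on (\<Omega> \<times> R) (\<lambda>z. harmonic_flow \<omega> a (snd z) (fst z))"
proof -
  have "continuous_on (\<Omega> \<times> R) (\<lambda>z. a (fst z))"
    by (intro continuous_on_compose2[OF C1_on_imp_continuous_on[OF assms]] continuous_intros) auto
  then show ?thesis unfolding harmonic_flow_def by (intro continuous_intros)
qed

lemma continuous_on_jacobian_harmonic_flow:
  fixes a :: "real^'d \<Rightarrow> complex^'d"
  assumes "open \<Omega>" "C1_on \<Omega> a"
  shows "continuous_on (\<Omega> \<times> R) (\<lambda>z. jacobian (harmonic_flow \<omega> a (snd z)) (at (fst z)))"
proof -
  have p: "continuous_on (\<Omega> \<times> R) (\<lambda>z. partial_deriv j a (fst z))" for j
    by (intro continuous_on_compose2[OF continuous_on_partial_deriv[OF assms]] continuous_intros) auto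
  have "continuous_on (\<Omega> \<times> R) (\<lambda>z. \<chi> k j. Re (partial_deriv j a (fst z) $ k * osc \<omega> (snd z)))"
    using p by (intro continuous_intros)
  moreover have "a differentiable (at x)" if "x \<in> \<Omega>" for x
    using assms that by (simp add: C1_on_open_iff)
  ultimately show ?thesis
    by (elim continuous_on_eq) (auto simp: jacobian_harmonic_flow)
qed

lemma continuous_on_G:
  fixes v :: "real \<Rightarrow> real^'d \<Rightarrow> real^'d"
  assumes "T > 0" "open \<Omega>" "C1_on ({0..T} \<times> \<Omega>) (\<lambda>(t, x). I t x)"
    and "continuous_on (\<Omega> \<times> {0..T}) (\<lambda>z. v (snd z) (fst z))"
  shows "continuous_on (\<Omega> \<times> {0..T}) (\<lambda>z. G T I v (snd z) (fst z))"
  unfolding G_def by (intro continuous_intros C1_on_time_space[OF assms(1-3)] assms(4))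

lemma continuous_on_w_D:
  fixes u :: "real \<Rightarrow> real^'d \<Rightarrow> real^'d"
  assumes "\<epsilon> > 0" "T > 0" "open \<Omega>" "C1_on ({0..T} \<times> \<Omega>) (\<lambda>(t, x). I t x)"
    and "C1_on ({0..T} \<times> \<Omega>) (\<lambda>(t, x). u t x)"
  shows "continuous_on (\<Omega> \<times> {0..T}) (\<lambda>z. G T I u (snd z) (fst z))"
    and "continuous_on (\<Omega> \<times> {0..T}) (\<lambda>z. w_D \<epsilon> T I u (snd z) (fst z))"
proof -
  have "continuous_on (\<Omega> \<times> {0..T}) (\<lambda>z. (\<lambda>(t, x). u t x) (snd z, fst z))"
    by (intro continuous_on_compose2[OF C1_on_imp_continuous_on[OF assms(5)]] continuous_intros) auto
  then show c: "continuous_on (\<Omega> \<times> {0..T}) (\<lambda>z. G T I u (snd z) (fst z))"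
    by (intro continuous_on_G assms) simp
  show "continuous_on (\<Omega> \<times> {0..T}) (\<lambda>z. w_D \<epsilon> T I u (snd z) (fst z))"
    unfolding w_D_def using assms(1) by (intro continuous_intros c) auto
qed

lemma continuous_on_energy_density:
  fixes a b :: "real^'d \<Rightarrow> complex^'d"
  assumes "\<epsilon> > 0" "T > 0" "open \<Omega>" "C1_on ({0..T} \<times> \<Omega>) (\<lambda>(t, x). I t x)"
    and "C1_on ({0..T} \<times> \<Omega>) (\<lambda>(t, x). u t x)" and a: "C1_on \<Omega> a" and b: "C1_on \<Omega> b"
  shows "continuous_on (\<Omega> \<times> {0..T}) (\<lambda>z. energy_density \<epsilon> lam T I u (harmonic_flow \<omega> a) (fst z) (snd z))"
    and "continuous_on (\<Omega> \<times> {0..T}) (\<lambda>z. energy_density_var1 \<epsilon> lam T I u (harmonic_flow \<omega> a) (harmonic_flow \<omega> b) (fst z) (snd z))"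
    and "continuous_on (\<Omega> \<times> {0..T}) (\<lambda>z. energy_density_var2 \<epsilon> lam T I u (harmonic_flow \<omega> b) (fst z) (snd z))"
proof -
  note c = continuous_on_w_D[OF assms(1-5)] C1_on_time_space[OF assms(2-4)]
    continuous_on_harmonic_flow[OF a] continuous_on_harmonic_flow[OF b]
    continuous_on_jacobian_harmonic_flow[OF assms(3) a] continuous_on_jacobian_harmonic_flow[OF assms(3) b]
    continuous_on_G[OF assms(2-4) continuous_on_harmonic_flow[OF a]]
  have "max \<epsilon> \<bar>y\<bar> \<noteq> 0" for y using assms(1) by auto
  then show "continuous_on (\<Omega> \<times> {0..T}) (\<lambda>z. energy_density \<epsilon> lam T I u (harmonic_flow \<omega> a) (fst z) (snd z))"
    unfolding energy_density_def q_def by (intro continuous_intros c) auto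
  show "continuous_on (\<Omega> \<times> {0..T}) (\<lambda>z. energy_density_var1 \<epsilon> lam T I u (harmonic_flow \<omega> a) (harmonic_flow \<omega> b) (fst z) (snd z))"
    unfolding energy_density_var1_def by (intro continuous_intros c)
  show "continuous_on (\<Omega> \<times> {0..T}) (\<lambda>z. energy_density_var2 \<epsilon> lam T I u (harmonic_flow \<omega> b) (fst z) (snd z))"
    unfolding energy_density_var2_def by (intro continuous_intros c) auto
qed

text \<open>Continuity on an open set does not prevent blow-up at the boundary; a support compactly
  inside does.\<close>

lemma set_integrable_compact_support:
  fixes f :: "'a::euclidean_space \<Rightarrow> 'b::{banach, second_countable_topology}"
  assumes "continuous_on S f" "compact K" "K \<subseteq> S" "\<And>x. x \<in> S - K \<Longrightarrow> f x = 0"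
  shows "set_integrable lborel S f"
proof -
  have "integrable lborel (\<lambda>x. indicator K x *\<^sub>R f x)"
    by (intro borel_integrable_compact assms continuous_on_subset[OF assms(1)])
  moreover have "indicator S x *\<^sub>R f x = indicator K x *\<^sub>R f x" for x
    using assms(3,4) by (auto simp: indicator_def)
  ultimately show ?thesis unfolding set_integrable_def by (simp only:)
qed

text \<open>No bound on \<open>a\<close> or on the data near the boundary is assumed. The compact
  support of \<open>b\<close> makes the linear and quadratic coefficients integrable, and the finite
  energy takes care of the constant one.\<close>

lemma first_variation_energy:
  fixes a b :: "real^'d \<Rightarrow> complex^'d"
  assumes \<Omega>: "open \<Omega>" and T: "T > 0" and lam: "lam > 0" and \<epsilon>: "\<epsilon> > 0"
    and I: "C1_on ({0..T} \<times> \<Omega>) (\<lambda>(t, x). I t x)" and u: "C1_on ({0..T} \<times> \<Omega>) (\<lambda>(t, x). u t x)"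
    and a: "C2_on \<Omega> a"
    and min: "is_arg_min (energy \<epsilon> lam T \<Omega> I u) (\<lambda>w. w \<in> harmonic_flows \<omega> \<Omega>) (harmonic_flow \<omega> a)"
    and fin: "energy \<epsilon> lam T \<Omega> I u (harmonic_flow \<omega> a) < \<infinity>"
    and b: "C2_on \<Omega> b" and K: "compact K" "K \<subseteq> \<Omega>" "\<And>x. x \<in> \<Omega> - K \<Longrightarrow> b x = 0"
  shows "(LINT x:\<Omega>|lborel. integral {0..T}
    (energy_density_var1 \<epsilon> lam T I u (harmonic_flow \<omega> a) (harmonic_flow \<omega> b) x)) = 0"
proof -
  let ?v = "harmonic_flow \<omega> a" and ?h = "harmonic_flow \<omega> b"
  let ?c = "\<lambda>s x. a x + s *\<^sub>R b x"
  let ?e = "\<lambda>x. integral {0..T} (energy_density \<epsilon> lam T I u ?v x)"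
  let ?l = "\<lambda>x. integral {0..T} (energy_density_var1 \<epsilon> lam T I u ?v ?h x)"
  let ?m = "\<lambda>x. integral {0..T} (energy_density_var2 \<epsilon> lam T I u ?h x)"
  note a1 = C2_on_imp_C1_on[OF a] and b1 = C2_on_imp_C1_on[OF b]
  note cont = continuous_on_energy_density[OF \<epsilon> T \<Omega> I u]
  have c: "C2_on \<Omega> (?c s)" for s
    using C2_on_add[OF a C2_on_bounded_linear[OF bounded_linear_scaleR_right b]] .
  have diff: "a differentiable (at x)" "b differentiable (at x)" if "x \<in> \<Omega>" for x
    using a1 b1 \<Omega> that by (auto simp: C1_on_open_iff)
  have int: "energy_density \<epsilon> lam T I u ?v x integrable_on {0..T}"
    "energy_density_var1 \<epsilon> lam T I u ?v ?h x integrable_on {0..T}"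
    "energy_density_var2 \<epsilon> lam T I u ?h x integrable_on {0..T}" if "x \<in> \<Omega>" for x
    by (rule integrable_continuous_interval, rule continuous_on_param_slice[OF _ that], rule cont[OF a1 b1])+
  have eq: "integral {0..T} (energy_density \<epsilon> lam T I u (harmonic_flow \<omega> (?c s)) x) = ?e x + s * ?l x + s\<^sup>2 * ?m x"
    if "x \<in> \<Omega>" for s x
  proof -
    have "energy_density \<epsilon> lam T I u (harmonic_flow \<omega> (?c s)) x = (\<lambda>t. energy_density \<epsilon> lam T I u ?v x t
        + s * energy_density_var1 \<epsilon> lam T I u ?v ?h x t + s\<^sup>2 * energy_density_var2 \<epsilon> lam T I u ?h x t)"
      by (rule ext, rule energy_density_add_scaleR[OF \<epsilon> diff[OF that]])
    then show ?thesis
      using int[OF that, THEN integrable_integral] by (auto intro!: integral_unique has_integral_add has_integral_mult_right)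
  qed
  have E: "energy \<epsilon> lam T \<Omega> I u (harmonic_flow \<omega> c)
      = (\<integral>\<^sup>+x\<in>\<Omega>. ennreal (integral {0..T} (energy_density \<epsilon> lam T I u (harmonic_flow \<omega> c) x)) \<partial>lborel)"
    if "C2_on \<Omega> c" for c
  proof (rule energy_eq_integral[OF \<epsilon> lam])
    show "continuous_on {0..T} (energy_density \<epsilon> lam T I u (harmonic_flow \<omega> c) x)" if "x \<in> \<Omega>" for x
      by (rule continuous_on_param_slice[OF cont(1)[OF C2_on_imp_C1_on[OF \<open>C2_on \<Omega> c\<close>] b1] that])
  qed
  have E': "energy \<epsilon> lam T \<Omega> I u (harmonic_flow \<omega> (?c s))
      = (\<integral>\<^sup>+x\<in>\<Omega>. ennreal (?e x + s * ?l x + s\<^sup>2 * ?m x) \<partial>lborel)" for s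
    unfolding E[OF c] by (intro nn_integral_cong) (auto simp: eq indicator_def)
  \<comment> \<open>Since \<open>\<Omega> - K\<close> is open, \<open>b\<close> vanishes near
    \<open>x\<close>, so its derivatives vanish at \<open>x\<close> too.\<close>
  have zero: "?l x = 0" "?m x = 0" if x: "x \<in> \<Omega> - K" for x
  proof -
    have "b x = 0" using K(3) x .
    moreover have "partial_deriv j b x = 0" for j
      using x \<Omega> K compact_imp_closed by (intro partial_deriv_eq_0[of "\<Omega> - K"]) auto
    ultimately have "?h t x = 0" "jacobian (?h t) (at x) = 0" for t
      using diff x by (auto simp: harmonic_flow_def jacobian_harmonic_flow vec_eq_iff)
    then show "?l x = 0" "?m x = 0"
      by (simp_all add: energy_density_var1_def energy_density_var2_def cong: integral_cong)
  qed
  show ?thesis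
  proof (rule first_variation_eq_0[where e = ?e and m = ?m])
    show "\<Omega> \<in> sets lborel" using \<Omega> by simp
    have ce: "continuous_on \<Omega> ?e" by (rule continuous_on_param_integral[OF cont(1)[OF a1 b1]])
    then show "set_borel_measurable lborel \<Omega> ?e"
      using borel_measurable_continuous_on_indicator[OF _ ce] \<Omega> by (simp add: set_borel_measurable_def)
    show "set_integrable lborel \<Omega> ?l"
      by (rule set_integrable_compact_support[OF _ K(1,2)], rule continuous_on_param_integral[OF cont(2)[OF a1 b1]],
          erule zero(1))
    show "set_integrable lborel \<Omega> ?m"
      by (rule set_integrable_compact_support[OF _ K(1,2)], rule continuous_on_param_integral[OF cont(3)[OF a1 b1]],
          erule zero(2))
    show "0 \<le> ?e x + s * ?l x + s\<^sup>2 * ?m x" if "x \<in> \<Omega>" for s x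
      unfolding eq[OF that, symmetric]
      by (intro integral_nonneg integrable_continuous_interval energy_density_nonneg \<epsilon> lam
          continuous_on_param_slice[OF cont(1)[OF C2_on_imp_C1_on[OF c] b1] that])
    show "(\<integral>\<^sup>+x\<in>\<Omega>. ennreal (?e x) \<partial>lborel) < \<infinity>"
      using fin unfolding E[OF a] .
    show "(\<integral>\<^sup>+x\<in>\<Omega>. ennreal (?e x) \<partial>lborel) \<le> (\<integral>\<^sup>+x\<in>\<Omega>. ennreal (?e x + s * ?l x + s\<^sup>2 * ?m x) \<partial>lborel)" for s
    proof -
      have "harmonic_flow \<omega> (?c s) \<in> harmonic_flows \<omega> \<Omega>"
        using c[of s] unfolding harmonic_flows_def by auto
      then have "energy \<epsilon> lam T \<Omega> I u ?v \<le> energy \<epsilon> lam T \<Omega> I u (harmonic_flow \<omega> (?c s))"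
        using min unfolding is_arg_min_def by (simp add: not_less)
      then show ?thesis unfolding E' E[OF a] .
    qed
  qed
qed

subsection \<open>The Euler-Lagrange equation\<close>

lemma partial_deriv_scaleR:
  assumes "f differentiable (at x)" "g differentiable (at x)"
  shows "partial_deriv j (\<lambda>x. f x *\<^sub>R g x) x = f x *\<^sub>R partial_deriv j g x + partial_deriv j f x *\<^sub>R g x"
proof -
  have "((\<lambda>x. f x *\<^sub>R g x) has_derivative
      (\<lambda>h. f x *\<^sub>R frechet_derivative g (at x) h + frechet_derivative f (at x) h *\<^sub>R g x)) (at x)"
    using assms by (intro has_derivative_scaleR) (simp_all add: frechet_derivative_works)
  from frechet_derivative_at[OF this] show ?thesis unfolding partial_deriv_def by metis
qed

lemma partial_deriv_bounded_linear:
  assumes "bounded_linear L" "f differentiable (at x)"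
  shows "partial_deriv j (\<lambda>x. L (f x)) x = L (partial_deriv j f x)"
proof -
  have "((\<lambda>x. L (f x)) has_derivative (\<lambda>h. L (frechet_derivative f (at x) h))) (at x)"
    using assms by (intro bounded_linear.has_derivative[OF assms(1)]) (simp add: frechet_derivative_works)
  from frechet_derivative_at[OF this] show ?thesis unfolding partial_deriv_def by metis
qed

text \<open>This is the divergence theorem without boundary terms. As \<open>f\<close> is C1 only on
  \<open>S\<close>, the product must first be recognised as C1 on the whole space.\<close>

lemma integral_bump_partial_deriv_eq_0:
  fixes f :: "real^'d \<Rightarrow> complex"
  assumes S: "open S" and f: "C1_on S f" and r: "0 < r" "cball z r \<subseteq> S"
  shows "set_integrable lborel S (partial_deriv j (\<lambda>x. bump z r x *\<^sub>R f x))"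
    and "(LINT x:S|lborel. partial_deriv j (\<lambda>x. bump z r x *\<^sub>R f x) x) = 0"
proof -
  let ?P = "\<lambda>x. bump z r x *\<^sub>R f x"
  have P0: "?P x = 0" if "x \<notin> cball z r" for x
    using bump_eq_0[of x z r] that r(1) by simp
  have "C1_on (- cball z r) ?P"
    using C1_on_cong[of "- cball z r" ?P "\<lambda>x. 0"] C1_on_const[of "- cball z r" 0] P0 by auto
  moreover have "C1_on S ?P"
    by (intro C1_on_scaleR f C2_on_imp_C1_on[OF C2_on_bump])
  \<comment> \<open>The two open sets cover the space because the closed ball lies in
    \<open>S\<close>. The product is smooth on \<open>S\<close> by the product rule and zero off the
    ball.\<close>
  ultimately have "C1_on (S \<union> - cball z r) ?P"
    using S by (intro C1_on_Un) auto
  moreover have "S \<union> - cball z r = UNIV" using r(2) by auto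
  ultimately have P: "C1_on UNIV ?P" by simp
  \<comment> \<open>Hence the integral over \<open>S\<close> equals the integral over the whole
    space.\<close>
  have "partial_deriv j ?P x = 0" if "x \<notin> S" for x
    using that r(2) P0 by (intro partial_deriv_eq_0[of "- cball z r"]) auto
  then have "indicator S x *\<^sub>R partial_deriv j ?P x = partial_deriv j ?P x" for x
    by (auto simp: indicator_def)
  with integral_partial_deriv_eq_0[OF P compact_cball P0, where j = j]
  show "set_integrable lborel S (partial_deriv j ?P)" "(LINT x:S|lborel. partial_deriv j ?P x) = 0"
    unfolding set_integrable_def set_lebesgue_integral_def by simp_all
qed

lemma has_integral_fourier:
  assumes "continuous_on {0..T} (\<lambda>t. f t x)"
  shows "((\<lambda>t. of_real (f t x) * exp (- (\<i> * of_real (t * \<nu>)))) has_integral fourier T f \<nu> x) {0..T}"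
  unfolding fourier_eq_integral[where f = f, OF assms] using assms
  by (intro integrable_integral integrable_continuous_interval continuous_intros)

text \<open>The direction has only a \<open>k\<close>-th component, which collapses all sums over
  components. The data term becomes a Fourier coefficient and the smoothness term is integrated by
  \<open>integral_Re_osc_mult\<close>.\<close>

lemma integral_energy_density_var1_bump:
  fixes a :: "real^'d \<Rightarrow> complex^'d"
  assumes \<omega>: "\<omega> \<noteq> 0" "T = 2 * pi * real p / \<omega>" and T: "T > 0"
    and x: "a differentiable (at x)"
    and cont: "continuous_on {0..T} (\<lambda>t. w_D \<epsilon> T I u t x * G T I (harmonic_flow \<omega> a) t x * grad (I t) x $ k)"
  shows "integral {0..T} (energy_density_var1 \<epsilon> lam T I u (harmonic_flow \<omega> a)
      (harmonic_flow \<omega> (\<lambda>x. bump z r x *\<^sub>R axis k \<gamma>)) x) =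
    Re (cnj \<gamma> * (bump z r x *\<^sub>R fourier T (\<lambda>t x. w_D \<epsilon> T I u t x * G T I (harmonic_flow \<omega> a) t x * grad (I t) x $ k) \<omega> x
      + (lam * T) *\<^sub>R (\<Sum>j\<in>UNIV. partial_deriv j (bump z r) x *\<^sub>R partial_deriv j (\<lambda>y. a y $ k) x)))"
    (is "integral _ (energy_density_var1 _ _ _ _ _ ?v ?h x) = Re (cnj \<gamma> * (_ *\<^sub>R fourier T ?f \<omega> x + _))")
proof -
  have bump: "bump z r differentiable (at x)"
    using C2_on_imp_C1_on[OF C2_on_bump[of UNIV z r]] by (simp add: C1_on_open_iff)
  have axis: "bounded_linear (\<lambda>s. s *\<^sub>R axis k \<gamma>)" by (rule bounded_linear_scaleR_left)
  have a: "partial_deriv j (\<lambda>y. a y $ k) x = partial_deriv j a x $ k" for j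
    by (rule partial_deriv_bounded_linear[OF bounded_linear_vec_nth x])
  have db: "(\<lambda>x. bump z r x *\<^sub>R axis k \<gamma>) differentiable (at x)"
    using bump by simp
  have h: "grad (I t) x \<bullet> ?h t x = bump z r x * Re (cnj \<gamma> * exp (- (\<i> * of_real (t * \<omega>)))) * grad (I t) x $ k" for t
  proof -
    \<comment> \<open>Conjugating under the real part turns the oscillation into the Fourier kernel
      at \<open>\<omega>\<close>.\<close>
    have "Re (\<gamma> * osc \<omega> t) = Re (cnj (\<gamma> * osc \<omega> t))" by (simp only: cnj.sel)
    also have "cnj (\<gamma> * osc \<omega> t) = cnj \<gamma> * exp (- (\<i> * of_real (t * \<omega>)))"
      by (simp add: exp_cnj mult.commute)
    finally have *: "Re (\<gamma> * osc \<omega> t) = Re (cnj \<gamma> * exp (- (\<i> * of_real (t * \<omega>))))" .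
    have "grad (I t) x \<bullet> ?h t x = (\<Sum>i\<in>UNIV. if i = k then grad (I t) x $ k * (bump z r x * Re (\<gamma> * osc \<omega> t)) else 0)"
      unfolding inner_vec_def harmonic_flow_def by (rule sum.cong) (auto simp: axis_def algebra_simps)
    then show ?thesis unfolding * by (simp add: mult_ac)
  qed
  have J: "jacobian (?v t) (at x) \<bullet> jacobian (?h t) (at x) =
      (\<Sum>j\<in>UNIV. partial_deriv j (bump z r) x * (Re (partial_deriv j (\<lambda>y. a y $ k) x * osc \<omega> t) * Re (\<gamma> * osc \<omega> t)))" for t
  proof -
    have "jacobian (?v t) (at x) \<bullet> jacobian (?h t) (at x) = (\<Sum>i\<in>UNIV. if i = k then
      (\<Sum>j\<in>UNIV. partial_deriv j (bump z r) x * (Re (partial_deriv j a x $ k * osc \<omega> t) * Re (\<gamma> * osc \<omega> t))) else 0)"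
      unfolding jacobian_harmonic_flow[OF x] jacobian_harmonic_flow[OF db] partial_deriv_bounded_linear[OF axis bump]
        inner_vec_def
      by (rule sum.cong) (auto simp: axis_def algebra_simps intro!: sum.cong)
    then show ?thesis by (simp add: a)
  qed
  have i1: "((\<lambda>t. bump z r x * Re (cnj \<gamma> * (of_real (?f t x) * exp (- (\<i> * of_real (t * \<omega>))))))
      has_integral bump z r x * Re (cnj \<gamma> * fourier T ?f \<omega> x)) {0..T}"
    using has_integral_linear[OF has_integral_mult_right[where c = "cnj \<gamma>",
          OF has_integral_fourier[where f = ?f, OF cont]] bounded_linear_Re]
    unfolding o_def by (rule has_integral_mult_right)
  have i2: "((\<lambda>t. Re (A * osc \<omega> t) * Re (\<gamma> * osc \<omega> t)) has_integral T / 2 * Re (A * cnj \<gamma>)) {0..T}" for A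
    unfolding integral_Re_osc_mult[OF \<omega> T, symmetric]
    by (intro integrable_integral integrable_continuous_interval continuous_intros)
  have "((\<lambda>t. bump z r x * Re (cnj \<gamma> * (of_real (?f t x) * exp (- (\<i> * of_real (t * \<omega>)))))
      + 2 * lam * (\<Sum>j\<in>UNIV. partial_deriv j (bump z r) x * (Re (partial_deriv j (\<lambda>y. a y $ k) x * osc \<omega> t) * Re (\<gamma> * osc \<omega> t))))
      has_integral bump z r x * Re (cnj \<gamma> * fourier T ?f \<omega> x)
      + 2 * lam * (\<Sum>j\<in>UNIV. partial_deriv j (bump z r) x * (T / 2 * Re (partial_deriv j (\<lambda>y. a y $ k) x * cnj \<gamma>)))) {0..T}"
    by (intro has_integral_add has_integral_mult_right has_integral_sum i1 i2) simp
  moreover have "energy_density_var1 \<epsilon> lam T I u ?v ?h x t =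
      bump z r x * Re (cnj \<gamma> * (of_real (?f t x) * exp (- (\<i> * of_real (t * \<omega>)))))
      + 2 * lam * (\<Sum>j\<in>UNIV. partial_deriv j (bump z r) x * (Re (partial_deriv j (\<lambda>y. a y $ k) x * osc \<omega> t) * Re (\<gamma> * osc \<omega> t)))" for t
  proof -
    have "Re (cnj \<gamma> * (of_real (?f t x) * exp (- (\<i> * of_real (t * \<omega>))))) =
        ?f t x * Re (cnj \<gamma> * exp (- (\<i> * of_real (t * \<omega>))))"
      by (simp add: algebra_simps)
    then show ?thesis
      unfolding energy_density_var1_def h J by (simp only: mult_ac)
  qed
  ultimately have "integral {0..T} (energy_density_var1 \<epsilon> lam T I u ?v ?h x) = bump z r x * Re (cnj \<gamma> * fourier T ?f \<omega> x)
      + 2 * lam * (\<Sum>j\<in>UNIV. partial_deriv j (bump z r) x * (T / 2 * Re (partial_deriv j (\<lambda>y. a y $ k) x * cnj \<gamma>)))"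
    by (intro integral_unique) presburger
  \<comment> \<open>The factor \<open>2\<close> from differentiating the square cancels the
    \<open>1 / 2\<close> from the time average.\<close>
  also have "2 * lam * (\<Sum>j\<in>UNIV. partial_deriv j (bump z r) x * (T / 2 * Re (partial_deriv j (\<lambda>y. a y $ k) x * cnj \<gamma>)))
      = Re (cnj \<gamma> * ((lam * T) *\<^sub>R (\<Sum>j\<in>UNIV. partial_deriv j (bump z r) x *\<^sub>R partial_deriv j (\<lambda>y. a y $ k) x)))"
    unfolding sum_distrib_left scaleR_sum_right Re_sum
    by (intro sum.cong) (simp_all add: algebra_simps)
  finally show ?thesis
    by (simp add: algebra_simps)
qed

lemma set_integral_bounded_linear:
  fixes f :: "'a \<Rightarrow> 'b::{banach, second_countable_topology}"
    and L :: "'b \<Rightarrow> 'c::{banach, second_countable_topology}"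
  assumes L: "bounded_linear L" and f: "set_integrable M S f"
  shows "set_integrable M S (\<lambda>x. L (f x))"
    and "(LINT x:S|M. L (f x)) = L (LINT x:S|M. f x)"
proof -
  have L': "indicator S x *\<^sub>R L (f x) = L (indicator S x *\<^sub>R f x)" for x
    using linear_scale[OF bounded_linear.linear[OF L]] by simp
  have f': "integrable M (\<lambda>x. indicator S x *\<^sub>R f x)" using f unfolding set_integrable_def .
  show "set_integrable M S (\<lambda>x. L (f x))"
    unfolding set_integrable_def L' by (rule integrable_bounded_linear[OF L f'])
  show "(LINT x:S|M. L (f x)) = L (LINT x:S|M. f x)"
    unfolding set_lebesgue_integral_def L' by (rule integral_bounded_linear[OF L f'])
qed

lemma euler_lagrange:
  fixes a :: "real^'d \<Rightarrow> complex^'d"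
  assumes \<Omega>: "open \<Omega>" and \<omega>: "T = 2 * pi * real p / \<omega>" and T: "T > 0" and lam: "lam > 0" and \<epsilon>: "\<epsilon> > 0"
    and I: "C1_on ({0..T} \<times> \<Omega>) (\<lambda>(t, x). I t x)" and u: "C1_on ({0..T} \<times> \<Omega>) (\<lambda>(t, x). u t x)"
    and a: "C2_on \<Omega> a"
    and min: "is_arg_min (energy \<epsilon> lam T \<Omega> I u) (\<lambda>w. w \<in> harmonic_flows \<omega> \<Omega>) (harmonic_flow \<omega> a)"
    and fin: "energy \<epsilon> lam T \<Omega> I u (harmonic_flow \<omega> a) < \<infinity>"
    and z: "z \<in> \<Omega>"
  shows "fourier T (\<lambda>t x. w_D \<epsilon> T I u t x * G T I (harmonic_flow \<omega> a) t x * grad (I t) x $ k) \<omega> z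
    = (lam * T) *\<^sub>R laplacian a z $ k"
proof -
  let ?v = "harmonic_flow \<omega> a"
  let ?f = "\<lambda>t x. w_D \<epsilon> T I u t x * G T I ?v t x * grad (I t) x $ k"
  let ?A = "\<lambda>y. a y $ k"
  \<comment> \<open>\<open>?R\<close> is the residual of the claimed equation.\<close>
  let ?R = "\<lambda>x. fourier T ?f \<omega> x - (lam * T) *\<^sub>R laplacian a x $ k"
  \<comment> \<open>Division by zero yields \<open>0\<close>, so \<open>\<omega> = 0\<close> would
    force \<open>T = 0\<close>.\<close>
  have \<omega>0: "\<omega> \<noteq> 0" using \<omega> T by auto
  note a1 = C2_on_imp_C1_on[OF a]
  have A2: "C2_on \<Omega> ?A" by (rule C2_on_bounded_linear[OF bounded_linear_vec_nth a])
  have pA: "C1_on \<Omega> (partial_deriv j ?A)" for j by (rule C1_on_partial_deriv[OF \<Omega> A2])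
  have diff: "a differentiable (at x)" "partial_deriv j ?A differentiable (at x)" if "x \<in> \<Omega>" for x j
    using a1 pA \<Omega> that by (auto simp: C1_on_open_iff)
  have bump: "bump y r differentiable (at x)" for y r and x :: "real^'d"
    using C2_on_imp_C1_on[OF C2_on_bump[of UNIV y r]] by (simp add: C1_on_open_iff)
  have cf: "continuous_on (\<Omega> \<times> {0..T}) (\<lambda>z. ?f (snd z) (fst z))"
    by (intro continuous_intros continuous_on_w_D[OF \<epsilon> T \<Omega> I u] C1_on_time_space[OF T \<Omega> I]
        continuous_on_G[OF T \<Omega> I continuous_on_harmonic_flow[OF a1]])
  have cft: "continuous_on {0..T} (\<lambda>t. ?f t x)" if "x \<in> \<Omega>" for x
    by (rule continuous_on_param_slice[where f = "\<lambda>x t. ?f t x", OF cf that])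
  have cF: "continuous_on \<Omega> (fourier T ?f \<omega>)"
  proof (rule continuous_on_eq)
    show "continuous_on \<Omega> (\<lambda>x. integral {0..T} (\<lambda>t. of_real (?f t x) * exp (- (\<i> * of_real (t * \<omega>)))))"
      by (intro continuous_on_param_integral continuous_intros cf)
  qed (simp add: fourier_eq_integral[where f = ?f, OF cft])
  have cR: "continuous_on \<Omega> ?R"
    using cF continuous_on_partial_deriv[OF \<Omega> pA] by (simp add: laplacian_def) (intro continuous_intros)
  have main: "Re (cnj \<gamma> * ?R z) = 0" for \<gamma>
  proof (rule fundamental_lemma_bump[OF \<Omega> z])
    show "continuous_on \<Omega> (\<lambda>x. Re (cnj \<gamma> * ?R x))"
      using cR by (intro continuous_on_Re continuous_on_mult_left)
    fix r :: real assume r: "0 < r" "cball z r \<subseteq> \<Omega>"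
    let ?b = "\<lambda>x. bump z r x *\<^sub>R axis k \<gamma>"
    let ?l = "\<lambda>x. integral {0..T} (energy_density_var1 \<epsilon> lam T I u ?v (harmonic_flow \<omega> ?b) x)"
    let ?P = "\<lambda>j x. bump z r x *\<^sub>R partial_deriv j ?A x"
    have b: "C2_on \<Omega> ?b" by (rule C2_on_bounded_linear[OF bounded_linear_scaleR_left C2_on_bump])
    have b0: "?b x = 0" if "x \<in> \<Omega> - cball z r" for x
      using that r(1) bump_eq_0[of x z r] by simp
    have l0: "(LINT x:\<Omega>|lborel. ?l x) = 0"
      by (rule first_variation_energy[OF \<Omega> T lam \<epsilon> I u a min fin b compact_cball r(2) b0])
    have P: "set_integrable lborel \<Omega> (partial_deriv j (?P j))" "(LINT x:\<Omega>|lborel. partial_deriv j (?P j) x) = 0" for j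
      by (rule integral_bump_partial_deriv_eq_0[OF \<Omega> pA r])+
    let ?D = "\<lambda>x. \<Sum>j\<in>UNIV. partial_deriv j (?P j) x"
    have Di: "set_integrable lborel \<Omega> ?D"
      using P(1) unfolding set_integrable_def scaleR_sum_right by (rule Bochner_Integration.integrable_sum)
    have D0: "(LINT x:\<Omega>|lborel. ?D x) = 0"
    proof -
      have "(LINT x:\<Omega>|lborel. ?D x) = (LINT x|lborel. (\<Sum>j\<in>UNIV. indicator \<Omega> x *\<^sub>R partial_deriv j (?P j) x))"
        unfolding set_lebesgue_integral_def scaleR_sum_right ..
      also have "\<dots> = (\<Sum>j\<in>UNIV. (LINT x:\<Omega>|lborel. partial_deriv j (?P j) x))"
        using P(1) unfolding set_lebesgue_integral_def set_integrable_def by (rule Bochner_Integration.integral_sum)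
      finally show ?thesis by (simp only: P(2) sum.neutral_const)
    qed
    \<comment> \<open>By the product rule \<open>?D\<close>, the divergence of the bump times the
      gradient of \<open>?A\<close>, splits into a Laplacian term and the mixed gradient term of the
      variation. So \<open>?l\<close> differs from the tested residual by a term of integral
      zero.\<close>
    have l: "?l x = bump z r x * Re (cnj \<gamma> * ?R x) + lam * T * Re (cnj \<gamma> * ?D x)" if "x \<in> \<Omega>" for x
    proof -
      have "?D x = bump z r x *\<^sub>R laplacian a x $ k
          + (\<Sum>j\<in>UNIV. partial_deriv j (bump z r) x *\<^sub>R partial_deriv j ?A x)"
        using diff[OF that] bump
        by (simp add: partial_deriv_scaleR laplacian_def sum.distrib scaleR_sum_right)
      then show ?thesis
        unfolding integral_energy_density_var1_bump[OF \<omega>0 \<omega> T diff(1)[OF that] cft[OF that]]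
        by (simp add: algebra_simps)
    qed
    have Bi: "set_integrable lborel \<Omega> (\<lambda>x. bump z r x * Re (cnj \<gamma> * ?R x))"
      using cR C1_on_imp_continuous_on[OF C2_on_imp_C1_on[OF C2_on_bump]] bump_eq_0[of _ z r] r
      by (intro set_integrable_compact_support[OF _ compact_cball r(2)] continuous_on_mult
          continuous_on_Re continuous_on_mult_left) auto
    have L: "bounded_linear (\<lambda>c. lam * T * Re (cnj \<gamma> * c))"
      by (intro bounded_linear_const_mult bounded_linear_compose[OF bounded_linear_Re] bounded_linear_mult_right)
    note Li = set_integral_bounded_linear(1)[where L = "\<lambda>c. lam * T * Re (cnj \<gamma> * c)", OF L Di]
    have "(LINT x:\<Omega>|lborel. lam * T * Re (cnj \<gamma> * ?D x)) = lam * T * Re (cnj \<gamma> * 0)"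
      unfolding set_integral_bounded_linear(2)[where L = "\<lambda>c. lam * T * Re (cnj \<gamma> * c)", OF L Di] D0 ..
    then have L0: "(LINT x:\<Omega>|lborel. lam * T * Re (cnj \<gamma> * ?D x)) = 0"
      by (simp only: mult_zero_right zero_complex.sel)
    have "(LINT x:\<Omega>|lborel. bump z r x * Re (cnj \<gamma> * ?R x)) =
        (LINT x:\<Omega>|lborel. bump z r x * Re (cnj \<gamma> * ?R x) + lam * T * Re (cnj \<gamma> * ?D x))"
      by (simp only: set_integral_add(2)[OF Bi Li] L0 add_0_right)
    also have "\<dots> = (LINT x:\<Omega>|lborel. ?l x)"
    proof (rule set_lebesgue_integral_cong)
      show "\<Omega> \<in> sets lborel" using \<Omega> by simp
    qed (intro allI impI, erule l[symmetric])
    also have "\<dots> = 0" by (rule l0)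
    finally show "(LINT x:\<Omega>|lborel. bump z r x * Re (cnj \<gamma> * ?R x)) = 0" .
  qed
  \<comment> \<open>The test value \<open>1\<close> isolates the real part and \<open>\<i>\<close>
    the imaginary part.\<close>
  have "Re (?R z) = 0" "Im (?R z) = 0" using main[of 1] main[of \<i>] by simp_all
  then have "?R z = 0" by (simp add: complex_eq_iff)
  then show ?thesis by simp
qed

theorem theorem7:
  fixes \<Omega> :: "(real^'d) set"
    and \<omega> T lam \<epsilon> :: real and p :: nat
    and I :: "real \<Rightarrow> real^'d \<Rightarrow> real"
    and u v :: "real \<Rightarrow> real^'d \<Rightarrow> real^'d"
    and a :: "real^'d \<Rightarrow> complex^'d"
  assumes "open \<Omega>" and "connected \<Omega>" and "\<Omega> \<noteq> {}" and "bounded \<Omega>"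
    and "T = 2 * pi * real p / \<omega>" and "T > 0"
    and "lam > 0" and "\<epsilon> > 0"
    and "C1_on ({0..T} \<times> \<Omega>) (\<lambda>(t, x). I t x)"
    and "C1_on ({0..T} \<times> \<Omega>) (\<lambda>(t, x). u t x)"
    and "C2_on \<Omega> a" and "v = harmonic_flow \<omega> a"
    and "is_arg_min (energy \<epsilon> lam T \<Omega> I u) (\<lambda>w. w \<in> harmonic_flows \<omega> \<Omega>) v"
    and "energy \<epsilon> lam T \<Omega> I u v < \<infinity>"
  shows "\<forall>x\<in>\<Omega>.
      fourier_mat T (\<lambda>t y. w_D \<epsilon> T I u t y *\<^sub>R outer_prod (grad (I t) y) (grad (I t) y)) 0 x *v a x
    + fourier_mat T (\<lambda>t y. w_D \<epsilon> T I u t y *\<^sub>R outer_prod (grad (I t) y) (grad (I t) y)) (2 * \<omega>) x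
        *v cnj_vec (a x)
    + 2 *\<^sub>R fourier_vec T (\<lambda>t y. (w_D \<epsilon> T I u t y * time_deriv T I t y) *\<^sub>R grad (I t) y) \<omega> x
    = (2 * lam * T) *\<^sub>R laplacian a x"
proof
  fix x assume x: "x \<in> \<Omega>"
  let ?g = "\<lambda>t y. grad (I t) y" and ?w = "w_D \<epsilon> T I u" and ?d = "\<lambda>t y. time_deriv T I t y"
  let ?E = "\<lambda>t \<nu>. exp (- (\<i> * of_real (t * \<nu>))) :: complex"
  note \<Omega> = \<open>open \<Omega>\<close> and T = \<open>T > 0\<close> and \<epsilon> = \<open>\<epsilon> > 0\<close>
  note c = continuous_on_w_D(2)[OF \<epsilon> T \<Omega> assms(9,10)] C1_on_time_space[OF T \<Omega> assms(9)]
    continuous_on_G[OF T \<Omega> assms(9) continuous_on_harmonic_flow[OF C2_on_imp_C1_on[OF assms(11)]]]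
  have ct: "continuous_on {0..T} (\<lambda>t. ?w t x)" "continuous_on {0..T} (\<lambda>t. ?g t x)"
    "continuous_on {0..T} (\<lambda>t. ?d t x)" "continuous_on {0..T} (\<lambda>t. G T I (harmonic_flow \<omega> a) t x)"
    by (rule continuous_on_param_slice[where f = "\<lambda>x t. ?w t x", OF c(1) x]
        continuous_on_param_slice[where f = "\<lambda>x t. ?g t x", OF c(2) x]
        continuous_on_param_slice[where f = "\<lambda>x t. ?d t x", OF c(3) x]
        continuous_on_param_slice[where f = "\<lambda>x t. G T I (harmonic_flow \<omega> a) t x", OF c(4) x])+
  have "(\<Sum>j\<in>UNIV. fourier T (\<lambda>t y. ?w t y * (?g t y $ k * ?g t y $ j)) 0 x * a x $ j)
      + (\<Sum>j\<in>UNIV. fourier T (\<lambda>t y. ?w t y * (?g t y $ k * ?g t y $ j)) (2 * \<omega>) x * cnj (a x $ j))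
      + 2 * fourier T (\<lambda>t y. ?w t y * ?d t y * ?g t y $ k) \<omega> x = (2 * lam * T) *\<^sub>R laplacian a x $ k"
    (is "?lhs = _") for k
  proof -
    let ?M = "\<lambda>j t y. ?w t y * (?g t y $ k * ?g t y $ j)"
    let ?f = "\<lambda>t y. ?w t y * G T I (harmonic_flow \<omega> a) t y * ?g t y $ k"
    \<comment> \<open>\<open>?r\<close> gathers the integrands of all Fourier coefficients on the
      left. The constant factor \<open>?E t 0\<close> is kept so that each summand has the Fourier
      form.\<close>
    let ?r = "\<lambda>t. (\<Sum>j\<in>UNIV. of_real (?M j t x) * ?E t 0 * a x $ j)
        + (\<Sum>j\<in>UNIV. of_real (?M j t x) * ?E t (2 * \<omega>) * cnj (a x $ j))
        + 2 * (of_real (?w t x * ?d t x * ?g t x $ k) * ?E t \<omega>)"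
    have M: "((\<lambda>t. of_real (?M j t x) * ?E t \<nu>) has_integral fourier T (?M j) \<nu> x) {0..T}" for j \<nu>
      by (rule has_integral_fourier) (intro continuous_intros ct)
    have d: "((\<lambda>t. of_real (?w t x * ?d t x * ?g t x $ k) * ?E t \<omega>) has_integral
        fourier T (\<lambda>t y. ?w t y * ?d t y * ?g t y $ k) \<omega> x) {0..T}"
      by (rule has_integral_fourier) (intro continuous_intros ct)
    have "(?r has_integral ?lhs) {0..T}"
      by (intro has_integral_add has_integral_sum has_integral_mult_left has_integral_mult_right M d) auto
    moreover have "((\<lambda>t. 2 * (of_real (?f t x) * ?E t \<omega>)) has_integral 2 * fourier T ?f \<omega> x) {0..T}"
      by (intro has_integral_mult_right has_integral_fourier continuous_intros ct)
    \<comment> \<open>The identity holds at each time, before integration; uniqueness of the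
      integral then transfers it to the coefficients.\<close>
    moreover have "?r t = 2 * (of_real (?f t x) * ?E t \<omega>)" for t
    proof -
      have osc: "2 * of_real (Re (c * osc \<omega> t)) * ?E t \<omega> = c * ?E t 0 + cnj c * ?E t (2 * \<omega>)" for c
      proof -
        have e: "cnj (osc \<omega> t) = ?E t \<omega>" "osc \<omega> t * ?E t \<omega> = ?E t 0" "?E t \<omega> * ?E t \<omega> = ?E t (2 * \<omega>)"
          by (auto simp: exp_cnj mult_exp_exp algebra_simps)
        have "2 * of_real (Re (c * osc \<omega> t)) = c * osc \<omega> t + cnj c * ?E t \<omega>"
          unfolding e(1)[symmetric] complex_cnj_mult[symmetric] by (rule complex_add_cnj[symmetric, simplified])
        then show ?thesis using e(2,3) by (simp only: distrib_right mult.assoc)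
      qed
      have "G T I (harmonic_flow \<omega> a) t x = (\<Sum>j\<in>UNIV. ?g t x $ j * Re (a x $ j * osc \<omega> t)) + ?d t x"
        by (simp add: G_def inner_vec_def harmonic_flow_def)
      then have "2 * (of_real (?f t x) * ?E t \<omega>) =
          (\<Sum>j\<in>UNIV. of_real (?M j t x) * (2 * of_real (Re (a x $ j * osc \<omega> t)) * ?E t \<omega>))
          + 2 * (of_real (?w t x * ?d t x * ?g t x $ k) * ?E t \<omega>)"
        by (simp add: sum_distrib_left sum_distrib_right algebra_simps)
      then show ?thesis unfolding osc by (simp add: sum.distrib distrib_left mult_ac)
    qed
    ultimately have "?lhs = 2 * fourier T ?f \<omega> x"
      using has_integral_unique by simp
    also have "\<dots> = (2 * lam * T) *\<^sub>R laplacian a x $ k"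
      using euler_lagrange[OF \<Omega> assms(5) T assms(7) \<epsilon> assms(9-11) assms(13,14)[unfolded assms(12)] x, of k]
      by (simp add: scaleR_conv_of_real)
    finally show ?thesis .
  qed
  then show "fourier_mat T (\<lambda>t y. ?w t y *\<^sub>R outer_prod (?g t y) (?g t y)) 0 x *v a x
    + fourier_mat T (\<lambda>t y. ?w t y *\<^sub>R outer_prod (?g t y) (?g t y)) (2 * \<omega>) x *v cnj_vec (a x)
    + 2 *\<^sub>R fourier_vec T (\<lambda>t y. (?w t y * ?d t y) *\<^sub>R ?g t y) \<omega> x
    = (2 * lam * T) *\<^sub>R laplacian a x"
    by (simp add: vec_eq_iff matrix_vector_mult_def fourier_mat_def fourier_vec_def outer_prod_def cnj_vec_def
        scaleR_conv_of_real[of 2])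
qed

end
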